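(* Let $p$ be an odd prime and let $G$ be an extraspecial, almost extraspecial or generalized extraspecial $p$-group. Let $n\geq 1$ and $k\geq 0$ be integers. (i) If $G\cong He_p^{\circ n}$, then $n_p(G)=p^{2n+1}-1$ and $\psi(G)=p^{2n+2}-p+1$. (ii) If $G\cong M_{p^3}^{\circ n}$, then $n_p(G)=p^{2n}-1$, $n_{p^2}(G)=(p-1)p^{2n}$ and $\psi(G)=(p-1)p^{2n+2}+p(p^{2n}-1)+1$. (iii) If $G\cong He_p^{\circ n}\circ C_{p^2}$, then $n_p(G)=p^{2n+1}-1$, $n_{p^2}(G)=(p-1)p^{2n+1}$ and $\psi(G)=(p-1)p^{2n+3}+p(p^{2n+1}-1)+1$. (iv) If $G\cong He_p^{\circ n}\times C_p^k$, then $n_p(G)=p^{2n+k+1}-1$ and $\psi(G)=p^{2n+k+2}-p+1$. (v) If $G\cong M_{p^3}^{\circ n}\times C_p^k$, then $n_p(G)=p^{2n+k}-1$, $n_{p^2}(G)=(p-1)p^{2n+k}$ and $\psi(G)=(p-1)p^{2n+k+2}+p(p^{2n+k}-1)+1$. (vi) If $G\cong (He_p^{\circ n}\circ C_{p^2})\times C_p^k$, then $n_p(G)=p^{2n+k+1}-1$, $n_{p^2}(G)=(p-1)p^{2n+k+1}$ and $\psi(G)=(p-1)p^{2n+k+3}+p(p^{2n+k+1}-1)+1$.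
   Context: For a prime $p$, a finite $p$-group $G$ is called special if either $G$ is elementary abelian, or $G$ is of nilpotency class $2$ and $G'=Z(G)=\Phi(G)$ is elementary abelian; extraspecial if $G$ is special and $|G'|=p$; almost extraspecial if $G'=\Phi(G)$, $|G'|=p$ and $Z(G)\cong C_{p^2}$; generalized extraspecial if $G'=\Phi(G)$, $|G'|=p$ and $G'\leq Z(G)$. Here $G'$, $Z(G)$, $\Phi(G)$ are the derived subgroup, center and Frattini subgroup. $C_m$ is the cyclic group of order $m$ and $C_p^k$ is the direct product of $k$ copies of $C_p$. For $p$ odd, $M_{p^3}=\langle x,y \mid x^{p^2}=y^p=1,\ y^{-1}xy=x^{p+1}\rangle$ is the modular group of order $p^3$, and $He_p=\langle x,y,z\mid x^p=y^p=z^p=1,\ [x,z]=[y,z]=1,\ [x,y]=z\rangle$ is the Heisenberg group modulo $p$, of order $p^3$. $G\circ H$ denotes the central product of $G$ and $H$: for the groups occurring here (each has a cyclic center), it is the quotient of $G\times H$ obtained by identifying, via an isomorphism, the unique subgroup of order $p$ of $Z(G)$ with the unique subgroup of order $p$ of $Z(H)$ (up to isomorphism the result does not depend on the choice of isomorphism for these groups). $G^{\circ n}$ is the central product of $n$ copies of $G$, with $G^{\circ 1}=G$. For a finite group $G$, $n_m(G)$ is the number of elements of order $m$ in $G$, and $\psi(G)=\sum_{x\in G}o(x)$, where $o(x)$ is the order of $x$. *)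

theory Defs
  imports "HOL-Algebra.Multiplicative_Group" "HOL-Algebra.Generated_Groups" "HOL-Algebra.Product_Groups"
    "HOL-Computational_Algebra.Primes"
begin

section \<open>Subgroups and classes of finite p-groups\<close>

definition group_center :: "('a, 'b) monoid_scheme \<Rightarrow> 'a set" where
  "group_center G = {z \<in> carrier G. \<forall>x \<in> carrier G. z \<otimes>\<^bsub>G\<^esub> x = x \<otimes>\<^bsub>G\<^esub> z}"

definition maximal_subgroup :: "'a set \<Rightarrow> ('a, 'b) monoid_scheme \<Rightarrow> bool" where
  "maximal_subgroup M G \<longleftrightarrow> subgroup M G \<and> M \<noteq> carrier G \<and>
     (\<forall>H. subgroup H G \<and> M \<subseteq> H \<longrightarrow> H = M \<or> H = carrier G)"

text \<open>The intersection of all maximal subgroups, which is all of \<open>G\<close> if there are none.\<close>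

definition frattini :: "('a, 'b) monoid_scheme \<Rightarrow> 'a set" where
  "frattini G = carrier G \<inter> \<Inter> {M. maximal_subgroup M G}"

abbreviation derived_subgroup :: "('a, 'b) monoid_scheme \<Rightarrow> 'a set" where
  "derived_subgroup G \<equiv> derived G (carrier G)"

text \<open>\<open>lower_central G i\<close> is the term \<open>[G, G, \<dots>, G]\<close> with \<open>i + 1\<close> entries, so that a group of
  nilpotency class \<open>c\<close> is one for which \<open>lower_central G c\<close> is the first trivial term.\<close>

primrec lower_central :: "('a, 'b) monoid_scheme \<Rightarrow> nat \<Rightarrow> 'a set" where
  "lower_central G 0 = carrier G"
| "lower_central G (Suc i) =
     generate G {h \<otimes>\<^bsub>G\<^esub> x \<otimes>\<^bsub>G\<^esub> inv\<^bsub>G\<^esub> h \<otimes>\<^bsub>G\<^esub> inv\<^bsub>G\<^esub> x | h x. h \<in> lower_central G i \<and> x \<in> carrier G}"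

definition has_nilpotency_class :: "('a, 'b) monoid_scheme \<Rightarrow> nat \<Rightarrow> bool" where
  "has_nilpotency_class G c \<longleftrightarrow>
     lower_central G c = {\<one>\<^bsub>G\<^esub>} \<and> (\<forall>i<c. lower_central G i \<noteq> {\<one>\<^bsub>G\<^esub>})"

definition finite_p_group :: "nat \<Rightarrow> ('a, 'b) monoid_scheme \<Rightarrow> bool" where
  "finite_p_group p G \<longleftrightarrow> group G \<and> finite (carrier G) \<and> (\<exists>a. order G = p ^ a)"

definition elementary_abelian :: "nat \<Rightarrow> ('a, 'b) monoid_scheme \<Rightarrow> bool" where
  "elementary_abelian p G \<longleftrightarrow> comm_group G \<and> (\<forall>x \<in> carrier G. x [^]\<^bsub>G\<^esub> p = \<one>\<^bsub>G\<^esub>)"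

definition special :: "nat \<Rightarrow> ('a, 'b) monoid_scheme \<Rightarrow> bool" where
  "special p G \<longleftrightarrow> finite_p_group p G \<and>
     (elementary_abelian p G \<or>
      has_nilpotency_class G 2 \<and>
      derived_subgroup G = group_center G \<and> group_center G = frattini G \<and>
      elementary_abelian p (G\<lparr>carrier := derived_subgroup G\<rparr>))"

definition extraspecial :: "nat \<Rightarrow> ('a, 'b) monoid_scheme \<Rightarrow> bool" where
  "extraspecial p G \<longleftrightarrow> special p G \<and> card (derived_subgroup G) = p"

definition almost_extraspecial :: "nat \<Rightarrow> ('a, 'b) monoid_scheme \<Rightarrow> bool" where
  "almost_extraspecial p G \<longleftrightarrow> finite_p_group p G \<and>
     derived_subgroup G = frattini G \<and> card (derived_subgroup G) = p \<and>
     G\<lparr>carrier := group_center G\<rparr> \<cong> integer_mod_group (p ^ 2)"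

definition generalized_extraspecial :: "nat \<Rightarrow> ('a, 'b) monoid_scheme \<Rightarrow> bool" where
  "generalized_extraspecial p G \<longleftrightarrow> finite_p_group p G \<and>
     derived_subgroup G = frattini G \<and> card (derived_subgroup G) = p \<and>
     derived_subgroup G \<subseteq> group_center G"

section \<open>Groups given by generators and relations\<close>

text \<open>A letter \<open>(g, True)\<close> stands for the generator \<open>g\<close> and \<open>(g, False)\<close> for its inverse.
  All elements of the type \<open>'g\<close> are generators. A pair \<open>(u, v)\<close> in \<open>R\<close> is the relation \<open>u = v\<close>.\<close>

type_synonym 'g word = "('g \<times> bool) list"

inductive word_eq :: "('g word \<times> 'g word) set \<Rightarrow> 'g word \<Rightarrow> 'g word \<Rightarrow> bool"
  for R :: "('g word \<times> 'g word) set" where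
  relation: "(u, v) \<in> R \<Longrightarrow> word_eq R u v"
| cancel: "word_eq R [(g, b), (g, \<not> b)] []"
| refl: "word_eq R u u"
| sym: "word_eq R u v \<Longrightarrow> word_eq R v u"
| trans: "word_eq R u v \<Longrightarrow> word_eq R v w \<Longrightarrow> word_eq R u w"
| append: "word_eq R u v \<Longrightarrow> word_eq R u' v' \<Longrightarrow> word_eq R (u @ u') (v @ v')"

definition presented_group :: "('g word \<times> 'g word) set \<Rightarrow> 'g word set monoid" where
  "presented_group R =
     \<lparr>carrier = UNIV // {(u, v). word_eq R u v},
      monoid.mult = (\<lambda>A B. {w. \<exists>u\<in>A. \<exists>v\<in>B. word_eq R (u @ v) w}),
      one = {w. word_eq R [] w}\<rparr>"

lemma presented_group_mult:
  "{w. word_eq R u w} \<otimes>\<^bsub>presented_group R\<^esub> {w. word_eq R v w} = {w. word_eq R (u @ v) w}"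
  by (auto simp: presented_group_def)
     (meson word_eq.append word_eq.trans, meson word_eq.refl)

lemma carrier_presented_group:
  "carrier (presented_group R) = range (\<lambda>u. {w. word_eq R u w})"
  by (auto simp: presented_group_def quotient_def)

lemma word_eq_left_inverse: "\<exists>v. word_eq R (v @ u) []"
proof (induction u)
  case Nil
  show ?case by (metis append_Nil word_eq.refl)
next
  case (Cons a u)
  obtain g b where a: "a = (g, b)" by (cases a)
  obtain v where v: "word_eq R (v @ u) []" using Cons by blast
  have "word_eq R [(g, \<not> b), (g, b)] []"
    using word_eq.cancel[of R g "\<not> b"] by simp
  hence "word_eq R (v @ [(g, \<not> b), (g, b)] @ u) (v @ [] @ u)"
    by (intro word_eq.append word_eq.refl)
  hence "word_eq R ((v @ [(g, \<not> b)]) @ a # u) []"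
    using v a by (auto intro: word_eq.trans)
  thus ?case by blast
qed

lemma group_presented_group: "group (presented_group R)"
proof (rule groupI)
  have one: "\<one>\<^bsub>presented_group R\<^esub> = {w. word_eq R [] w}"
    by (simp add: presented_group_def)
  show "\<one>\<^bsub>presented_group R\<^esub> \<in> carrier (presented_group R)"
    by (auto simp: one carrier_presented_group)
  fix x assume "x \<in> carrier (presented_group R)"
  then obtain u where u: "x = {w. word_eq R u w}" by (auto simp: carrier_presented_group)
  show "\<one>\<^bsub>presented_group R\<^esub> \<otimes>\<^bsub>presented_group R\<^esub> x = x"
    by (simp add: one u presented_group_mult)
  obtain v where v: "word_eq R (v @ u) []" using word_eq_left_inverse by blast
  have "{w. word_eq R v w} \<otimes>\<^bsub>presented_group R\<^esub> x = \<one>\<^bsub>presented_group R\<^esub>"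
    using v by (auto simp: one u presented_group_mult intro: word_eq.trans word_eq.sym)
  thus "\<exists>y\<in>carrier (presented_group R).
          y \<otimes>\<^bsub>presented_group R\<^esub> x = \<one>\<^bsub>presented_group R\<^esub>"
    by (auto simp: carrier_presented_group)
qed (auto simp: carrier_presented_group presented_group_mult)

abbreviation gen_power :: "'g \<Rightarrow> nat \<Rightarrow> 'g word" where
  "gen_power g m \<equiv> replicate m (g, True)"

definition gen_commutator :: "'g \<Rightarrow> 'g \<Rightarrow> 'g word" where
  "gen_commutator g h = [(g, False), (h, False), (g, True), (h, True)]"

datatype modular_gen = MX | MY

definition modular_group :: "nat \<Rightarrow> modular_gen word set monoid" where
  "modular_group p = presented_group
     {(gen_power MX (p ^ 2), []), (gen_power MY p, []),
      ([(MY, False), (MX, True), (MY, True)], gen_power MX (p + 1))}"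

datatype heisenberg_gen = HX | HY | HZ

definition heisenberg_group :: "nat \<Rightarrow> heisenberg_gen word set monoid" where
  "heisenberg_group p = presented_group
     {(gen_power HX p, []), (gen_power HY p, []), (gen_power HZ p, []),
      (gen_commutator HX HZ, []), (gen_commutator HY HZ, []),
      (gen_commutator HX HY, [(HZ, True)])}"

section \<open>Central products and direct powers\<close>

text \<open>\<open>K\<close> is isomorphic to the quotient of \<open>G \<times> H\<close> that identifies each \<open>a \<in> A\<close> with
  \<open>\<phi> a \<in> B\<close>, where \<open>A\<close> and \<open>B\<close> are subgroups of order \<open>p\<close> of the two centers and \<open>\<phi>\<close> is an
  isomorphism between them. If the centers are cyclic, then \<open>A\<close> and \<open>B\<close> are determined by
  \<open>G\<close>, \<open>H\<close> and \<open>p\<close>; no choice of \<open>\<phi>\<close> is preferred.\<close>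

definition is_central_product ::
    "nat \<Rightarrow> ('a, 'm) monoid_scheme \<Rightarrow> ('b, 'n) monoid_scheme \<Rightarrow> ('c, 'k) monoid_scheme \<Rightarrow> bool" where
  "is_central_product p G H K \<longleftrightarrow> group K \<and>
     (\<exists>A B \<phi>. subgroup A (G\<lparr>carrier := group_center G\<rparr>) \<and> card A = p \<and>
              subgroup B (H\<lparr>carrier := group_center H\<rparr>) \<and> card B = p \<and>
              \<phi> \<in> iso (G\<lparr>carrier := A\<rparr>) (H\<lparr>carrier := B\<rparr>) \<and>
              K \<cong> (G \<times>\<times> H) Mod {(a, inv\<^bsub>H\<^esub> (\<phi> a)) | a. a \<in> A})"

text \<open>\<open>is_central_power p G n K\<close> says that \<open>K\<close> is a central product of \<open>n\<close> copies of \<open>G\<close>. The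
  concrete quotients would live in types that grow with \<open>n\<close>, so \<open>K\<close> is taken on the fixed type
  \<open>nat\<close>; every finite group has an isomorphic copy there. The value at \<open>n = 0\<close> is not used.\<close>

fun is_central_power :: "nat \<Rightarrow> ('a, 'm) monoid_scheme \<Rightarrow> nat \<Rightarrow> nat monoid \<Rightarrow> bool" where
  "is_central_power p G 0 K \<longleftrightarrow> False"
| "is_central_power p G (Suc 0) K \<longleftrightarrow> group K \<and> K \<cong> G"
| "is_central_power p G (Suc (Suc n)) K \<longleftrightarrow>
     (\<exists>L. is_central_power p G (Suc n) L \<and> is_central_product p L G K)"

abbreviation cyclic_power :: "nat \<Rightarrow> nat \<Rightarrow> (nat \<Rightarrow> int) monoid" where
  "cyclic_power m k \<equiv> product_group {..<k} (\<lambda>_. integer_mod_group m)"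

section \<open>Element orders\<close>

definition num_of_order :: "nat \<Rightarrow> ('a, 'b) monoid_scheme \<Rightarrow> nat" where
  "num_of_order m G = card {x \<in> carrier G. group.ord G x = m}"

definition psi :: "('a, 'b) monoid_scheme \<Rightarrow> nat" where
  "psi G = (\<Sum>x \<in> carrier G. group.ord G x)"

end

theory Submission
  imports Defs
begin

text \<open>
  All groups in question have exponent dividing \<open>p\<^sup>2\<close>, so \<open>n\<^sub>p\<close>, the number of elements of order
  \<open>p\<^sup>2\<close> and \<open>\<psi>\<close> are determined by the order of the group and the number of solutions of \<open>x\<^sup>p = 1\<close>;
  both are multiplicative in direct products. For a central product, the \<open>p\<close>-th roots of the image
  of \<open>(x, y)\<close> are counted upstairs: they are the images of the pairs \<open>(g, h)\<close> with \<open>g\<^sup>p = x a\<close> and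
  \<open>h\<^sup>p = y \<phi>(a)\<^sup>-\<^sup>1\<close> for some \<open>a\<close> in the amalgamated subgroup, and each image is hit \<open>p\<close> times.
  The two groups of order \<open>p\<^sup>3\<close> are obtained as quotients of the Heisenberg group over the integers,
  in which \<open>p\<close>-th powers and commutators are explicit; here \<open>p\<close> divides \<open>p choose 2\<close> because \<open>p\<close> is odd.
\<close>

section \<open>Roots in quotients and central products\<close>

text \<open>Roots of \<open>1\<close> alone do not propagate through central products: the sum over
  the amalgamated subgroup also involves roots of other central elements, so \<open>roots\<close>
  takes an arbitrary target. For Heisenberg factors exponent \<open>p\<close> simply passes to
  quotients; for modular factors the roots of every central element are carried along. The
  amalgamating isomorphism is arbitrary; the counts use only that it is injective, has central
  values and preserves the identity. The second obstacle is that a presentation has no evident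
  normal form: its relations bound the group from above, but it might collapse. Two homomorphisms
  settle this, one from the integer Heisenberg group onto the presented group and one from there to
  an explicit quotient of the integer Heisenberg group. Their composite is the coset map, so the
  first has exactly the expected kernel. Integer coordinates keep the multiplication polynomial:
  reductions and the carry \<open>x^p = z^e\<close> are confined to the membership test for the
  kernel.\<close>

definition roots :: "('a, 'b) monoid_scheme \<Rightarrow> nat \<Rightarrow> 'a \<Rightarrow> 'a set" where
  "roots G m u = {x \<in> carrier G. x [^]\<^bsub>G\<^esub> m = u}"

text \<open>The fibres are cosets of the kernel, all of the same size. This carries every count in a
  quotient back to the group above it.\<close>

lemma (in group_hom) card_vimage_surj:
  assumes surj: "h ` carrier G = carrier H" and ker: "card (kernel G H h) = q"
    and S: "finite S" "S \<subseteq> carrier H"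
  shows "card {x \<in> carrier G. h x \<in> S} = q * card S"
proof (cases "finite (kernel G H h)")
  case True
  have fib: "card {x \<in> carrier G. h x = s} = q \<and> finite {x \<in> carrier G. h x = s}" if s: "s \<in> S" for s
  proof -
    obtain g where g: "g \<in> carrier G" "h g = s"
      using s S unfolding surj[symmetric] by auto
    have "bij_betw (\<lambda>k. g \<otimes> k) (kernel G H h) {x \<in> carrier G. h x = s}"
    proof (rule bij_betw_byWitness[where f' = "\<lambda>x. inv g \<otimes> x"])
      show "\<forall>a\<in>kernel G H h. inv g \<otimes> (g \<otimes> a) = a"
        using g by (simp add: kernel_def G.m_assoc[of "inv g" g, symmetric])
      show "\<forall>a'\<in>{x \<in> carrier G. h x = s}. g \<otimes> (inv g \<otimes> a') = a'"
        using g by (simp add: G.m_assoc[of g "inv g", symmetric])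
      show "(\<otimes>) g ` kernel G H h \<subseteq> {x \<in> carrier G. h x = s}"
        using g by (auto simp: kernel_def)
      show "(\<otimes>) (inv g) ` {x \<in> carrier G. h x = s} \<subseteq> kernel G H h"
        using g by (auto simp: kernel_def)
    qed
    from bij_betw_same_card[OF this] bij_betw_finite[OF this] show ?thesis using True ker by simp
  qed
  have "{x \<in> carrier G. h x \<in> S} = (\<Union>s\<in>S. {x \<in> carrier G. h x = s})" by auto
  also have "card \<dots> = (\<Sum>s\<in>S. card {x \<in> carrier G. h x = s})"
    using S fib by (intro card_UN_disjoint) auto
  finally show ?thesis using fib by simp
next
  case False
  \<comment> \<open>An infinite kernel means \<open>q = 0\<close>; for nonempty \<open>S\<close> the
    left side is then 0 as well, the preimage being infinite.\<close>
  have "infinite {x \<in> carrier G. h x \<in> S}" if s: "s \<in> S" for s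
  proof -
    obtain g where g: "g \<in> carrier G" "h g = s"
      using s S unfolding surj[symmetric] by auto
    have "(\<lambda>k. g \<otimes> k) ` kernel G H h \<subseteq> {x \<in> carrier G. h x \<in> S}"
      using g s by (auto simp: kernel_def)
    moreover have "inj_on (\<lambda>k. g \<otimes> k) (kernel G H h)"
      using g by (auto simp: inj_on_def kernel_def)
    ultimately show ?thesis using False finite_imageD finite_subset by blast
  qed
  thus ?thesis using False ker by (cases "S = {}") auto
qed

lemma DirProd_nat_pow:
  "x [^]\<^bsub>G \<times>\<times> H\<^esub> (m::nat) = (fst x [^]\<^bsub>G\<^esub> m, snd x [^]\<^bsub>H\<^esub> m)"
  by (induction m) (auto simp: mult_DirProd')

lemma group_centerD:
  "z \<in> group_center G \<Longrightarrow> z \<in> carrier G"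
  "z \<in> group_center G \<Longrightarrow> x \<in> carrier G \<Longrightarrow> z \<otimes>\<^bsub>G\<^esub> x = x \<otimes>\<^bsub>G\<^esub> z"
  by (auto simp: group_center_def)

lemma group_centerI:
  "z \<in> carrier G \<Longrightarrow> (\<And>x. x \<in> carrier G \<Longrightarrow> z \<otimes>\<^bsub>G\<^esub> x = x \<otimes>\<^bsub>G\<^esub> z) \<Longrightarrow> z \<in> group_center G"
  unfolding group_center_def by blast

lemma (in group) subgroup_group_center: "subgroup (group_center G) G"
proof
  show "x \<otimes> y \<in> group_center G" if xy: "x \<in> group_center G" "y \<in> group_center G" for x y
  proof -
    have "x \<otimes> y \<otimes> g = g \<otimes> (x \<otimes> y)" if "g \<in> carrier G" for g
    proof -
      have "x \<otimes> y \<otimes> g = x \<otimes> g \<otimes> y"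
        using that xy by (simp add: m_assoc group_centerD(1) group_centerD(2)[of y G g])
      also have "\<dots> = g \<otimes> (x \<otimes> y)"
        using that xy by (simp add: m_assoc group_centerD(1) group_centerD(2)[of x G g])
      finally show ?thesis .
    qed
    thus ?thesis using xy[THEN group_centerD(1)] by (intro group_centerI) auto
  qed
  show "inv x \<in> group_center G" if x: "x \<in> group_center G" for x
  proof -
    have "inv x \<otimes> g = g \<otimes> inv x" if "g \<in> carrier G" for g
      using that group_centerD[OF x] inv_mult_group[of x "inv g"] inv_mult_group[of "inv g" x] by simp
    thus ?thesis using group_centerD(1)[OF x] by (intro group_centerI) auto
  qed
qed (auto simp: group_center_def)

lemma is_isoE:
  assumes "G \<cong> H" "group G" "group H"
  obtains h where "group_hom G H h" "h ` carrier G = carrier H" "kernel G H h = {\<one>\<^bsub>G\<^esub>}"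
    "bij_betw h (carrier G) (carrier H)"
proof -
  obtain h where h: "h \<in> iso G H" using assms(1) by (auto simp: is_iso_def)
  then interpret group_hom G H h using assms by (simp add: group_hom_def group_hom_axioms_def iso_def)
  have b: "bij_betw h (carrier G) (carrier H)" using h by (simp add: iso_def)
  have "x = \<one>\<^bsub>G\<^esub>" if "x \<in> kernel G H h" for x
    using that inj_onD[OF bij_betw_imp_inj_on[OF b], of x "\<one>\<^bsub>G\<^esub>"] by (simp add: kernel_def)
  hence "kernel G H h = {\<one>\<^bsub>G\<^esub>}" by (auto simp: kernel_def)
  thus ?thesis using that b group_hom_axioms by (auto simp: bij_betw_def)
qed

text \<open>A central product is handled through the quotient map \<open>\<pi>\<close> composed with the isomorphism onto
  \<open>K\<close>, so that the cosets of \<open>is_central_product\<close> need not be mentioned again.\<close>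

locale central_product =
  L: group L + M: group M + K: group K + group_hom "L \<times>\<times> M" K \<pi>
  for p :: nat and L :: "('a, 'm) monoid_scheme" and M :: "('b, 'n) monoid_scheme"
    and K :: "('c, 'k) monoid_scheme" and A :: "'a set" and \<phi> :: "'a \<Rightarrow> 'b" and \<pi> :: "'a \<times> 'b \<Rightarrow> 'c" +
  assumes surj: "\<pi> ` carrier (L \<times>\<times> M) = carrier K"
    and kernel: "kernel (L \<times>\<times> M) K \<pi> = {(a, inv\<^bsub>M\<^esub> (\<phi> a)) | a. a \<in> A}"
    and A: "A \<subseteq> group_center L" "card A = p" "\<one>\<^bsub>L\<^esub> \<in> A"
    and \<phi>: "inj_on \<phi> A" "\<phi> ` A \<subseteq> group_center M" "\<phi> \<one>\<^bsub>L\<^esub> = \<one>\<^bsub>M\<^esub>"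

text \<open>The amalgamated pairs form a central, hence normal, subgroup \<open>D\<close>;
  \<open>\<pi>\<close> is the coset map followed by an isomorphism onto \<open>K\<close>, so its
  kernel is again \<open>D\<close>.\<close>

lemma central_productE:
  assumes "is_central_product p L M K" and L: "group L" and M: "group M"
  obtains A \<phi> \<pi> where "central_product p L M K A \<phi> \<pi>"
proof -
  interpret L: group L by fact
  interpret M: group M by fact
  interpret LM: group "L \<times>\<times> M" using L M by (rule DirProd_group)
  from assms(1) obtain A B \<phi> where K: "group K"
    and A: "subgroup A (L\<lparr>carrier := group_center L\<rparr>)" "card A = p"
    and B: "subgroup B (M\<lparr>carrier := group_center M\<rparr>)" "card B = p"
    and \<phi>: "\<phi> \<in> iso (L\<lparr>carrier := A\<rparr>) (M\<lparr>carrier := B\<rparr>)"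
    and iso: "K \<cong> (L \<times>\<times> M) Mod {(a, inv\<^bsub>M\<^esub> (\<phi> a)) | a. a \<in> A}"
    unfolding is_central_product_def by auto
  define D where "D = {(a, inv\<^bsub>M\<^esub> (\<phi> a)) | a. a \<in> A}"
  have AL: "subgroup A L" and BM: "subgroup B M"
    using L.incl_subgroup[OF L.subgroup_group_center A(1)]
      M.incl_subgroup[OF M.subgroup_group_center B(1)] by auto
  have Ac: "A \<subseteq> group_center L" and Bc: "B \<subseteq> group_center M"
    using subgroup.subset[OF A(1)] subgroup.subset[OF B(1)] by auto
  have bij: "bij_betw \<phi> A B" and mult: "\<And>a b. a \<in> A \<Longrightarrow> b \<in> A \<Longrightarrow> \<phi> (a \<otimes>\<^bsub>L\<^esub> b) = \<phi> a \<otimes>\<^bsub>M\<^esub> \<phi> b"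
    using \<phi> by (auto simp: iso_def hom_def)
  have "\<phi> \<in> hom (L\<lparr>carrier := A\<rparr>) (M\<lparr>carrier := B\<rparr>)" using \<phi> by (simp add: iso_def)
  hence one: "\<phi> \<one>\<^bsub>L\<^esub> = \<one>\<^bsub>M\<^esub>"
    using hom_one[OF _ subgroup.subgroup_is_group[OF AL L] subgroup.subgroup_is_group[OF BM M], of \<phi>] by simp
  have inA: "a \<in> carrier L" "\<phi> a \<in> carrier M" "\<phi> a \<in> group_center M" if "a \<in> A" for a
    using that Ac Bc bij_betwE[OF bij] by (blast dest: group_centerD(1))+
  have inv: "\<phi> (inv\<^bsub>L\<^esub> a) = inv\<^bsub>M\<^esub> (\<phi> a)" if "a \<in> A" for a
  proof (rule M.inv_equality[symmetric])
    show "\<phi> (inv\<^bsub>L\<^esub> a) \<otimes>\<^bsub>M\<^esub> \<phi> a = \<one>\<^bsub>M\<^esub>"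
      using mult[OF subgroup.m_inv_closed[OF AL that] that] inA[OF that] one by simp
  qed (use inA that subgroup.m_inv_closed[OF AL that] in blast)+
  have comm: "\<phi> a \<otimes>\<^bsub>M\<^esub> y = y \<otimes>\<^bsub>M\<^esub> \<phi> a" if "a \<in> A" "y \<in> carrier M" for a y
    using inA(3)[OF that(1)] that(2) by (rule group_centerD(2))
  have D: "subgroup D (L \<times>\<times> M)"
  proof
    show "D \<subseteq> carrier (L \<times>\<times> M)" using inA by (auto simp: D_def)
    show "\<one>\<^bsub>L \<times>\<times> M\<^esub> \<in> D" using one subgroup.one_closed[OF AL] by (force simp: D_def)
    show "u \<otimes>\<^bsub>L \<times>\<times> M\<^esub> v \<in> D" if uv: "u \<in> D" "v \<in> D" for u v
    proof -
      obtain a b where u: "u = (a, inv\<^bsub>M\<^esub> (\<phi> a))" "a \<in> A" and v: "v = (b, inv\<^bsub>M\<^esub> (\<phi> b))" "b \<in> A"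
        using uv by (auto simp: D_def)
      \<comment> \<open>Inversion reverses the product; centrality of the values of
        \<open>\<phi>\<close> restores the order of the factors.\<close>
      have "inv\<^bsub>M\<^esub> (\<phi> a) \<otimes>\<^bsub>M\<^esub> inv\<^bsub>M\<^esub> (\<phi> b) = inv\<^bsub>M\<^esub> (\<phi> (a \<otimes>\<^bsub>L\<^esub> b))"
        using u v inA comm[of a "\<phi> b"] by (simp add: mult M.inv_mult_group)
      thus ?thesis using u v subgroup.m_closed[OF AL] by (auto simp: D_def)
    qed
    show "inv\<^bsub>L \<times>\<times> M\<^esub> u \<in> D" if u: "u \<in> D" for u
    proof -
      obtain a where a: "u = (a, inv\<^bsub>M\<^esub> (\<phi> a))" "a \<in> A" using u by (auto simp: D_def)
      have "inv\<^bsub>L \<times>\<times> M\<^esub> u = (inv\<^bsub>L\<^esub> a, inv\<^bsub>M\<^esub> (\<phi> (inv\<^bsub>L\<^esub> a)))"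
        using a inA by (simp add: inv_DirProd[OF L M] inv)
      thus ?thesis using a subgroup.m_inv_closed[OF AL] by (auto simp: D_def)
    qed
  qed
  have central: "x \<otimes>\<^bsub>L \<times>\<times> M\<^esub> d = d \<otimes>\<^bsub>L \<times>\<times> M\<^esub> x" if d: "d \<in> D" and x: "x \<in> carrier (L \<times>\<times> M)" for x d
  proof -
    obtain a where a: "d = (a, inv\<^bsub>M\<^esub> (\<phi> a))" "a \<in> A" using d by (auto simp: D_def)
    have "inv\<^bsub>M\<^esub> (\<phi> a) \<in> group_center M"
      using subgroup.m_inv_closed[OF M.subgroup_group_center] a inA by auto
    moreover have "a \<in> group_center L" using a Ac by auto
    moreover obtain g h where "x = (g, h)" "g \<in> carrier L" "h \<in> carrier M" using x by auto
    ultimately show ?thesis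
      using a(1) group_centerD(2)[of a L g] group_centerD(2)[of "inv\<^bsub>M\<^esub> (\<phi> a)" M h] by simp
  qed
  have normal: "D \<lhd> (L \<times>\<times> M)"
    by (rule LM.normalI[OF D]) (use central in \<open>auto simp: r_coset_def l_coset_def\<close>)
  interpret N: normal D "L \<times>\<times> M" by (rule normal)
  interpret Q: group "(L \<times>\<times> M) Mod D" by (rule N.factorgroup_is_group)
  have "(L \<times>\<times> M) Mod D \<cong> K" using iso K group.iso_sym unfolding D_def by blast
  then obtain h where h: "group_hom ((L \<times>\<times> M) Mod D) K h"
    "h ` carrier ((L \<times>\<times> M) Mod D) = carrier K" "kernel ((L \<times>\<times> M) Mod D) K h = {\<one>\<^bsub>(L \<times>\<times> M) Mod D\<^esub>}"
    using is_isoE Q.is_group K by metis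
  define \<pi> where "\<pi> = h \<circ> (\<lambda>x. D #>\<^bsub>L \<times>\<times> M\<^esub> x)"
  have "\<pi> \<in> hom (L \<times>\<times> M) K"
    unfolding \<pi>_def by (rule hom_compose[OF N.r_coset_hom_Mod group_hom.homh[OF h(1)]])
  moreover have "\<pi> ` carrier (L \<times>\<times> M) = carrier K"
    using h(2) by (simp only: \<pi>_def image_comp[symmetric]) (simp add: FactGroup_def RCOSETS_def image_UN
       UNION_singleton_eq_range)
  moreover have "kernel (L \<times>\<times> M) K \<pi> = D"
  proof -
    have "\<pi> x = \<one>\<^bsub>K\<^esub> \<longleftrightarrow> x \<in> D" if x: "x \<in> carrier (L \<times>\<times> M)" for x
    proof -
      have "D #>\<^bsub>L \<times>\<times> M\<^esub> x \<in> carrier ((L \<times>\<times> M) Mod D)" using x by (auto simp: FactGroup_def RCOSETS_def)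
      hence "\<pi> x = \<one>\<^bsub>K\<^esub> \<longleftrightarrow> D #>\<^bsub>L \<times>\<times> M\<^esub> x = D"
        using h(3) by (auto simp: \<pi>_def kernel_def FactGroup_def)
      thus ?thesis using x D by (metis LM.coset_join1 LM.coset_join2 N.subset)
    qed
    thus ?thesis using N.subset by (auto simp: kernel_def)
  qed
  ultimately have "central_product p L M K A \<phi> \<pi>"
    using L M K LM.is_group Ac A(2) subgroup.one_closed[OF AL] bij Bc one
    by (auto simp: central_product_def group_hom_def group_hom_axioms_def central_product_axioms_def
        D_def bij_betw_def)
  thus ?thesis by (rule that)
qed

section \<open>Root counts and centers of central products\<close>

context central_product
begin

lemma A_carrier: "a \<in> A \<Longrightarrow> a \<in> carrier L" "a \<in> A \<Longrightarrow> \<phi> a \<in> carrier M"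
  using A(1) \<phi>(2) by (auto simp: group_center_def)

lemma card_kernel: "card (kernel (L \<times>\<times> M) K \<pi>) = p"
proof -
  have "kernel (L \<times>\<times> M) K \<pi> = (\<lambda>a. (a, inv\<^bsub>M\<^esub> (\<phi> a))) ` A" using kernel by auto
  thus ?thesis using A(2) by (simp add: card_image inj_on_def)
qed

lemma \<pi>_eq_iff:
  assumes "x \<in> carrier L" "x' \<in> carrier L" "y \<in> carrier M" "y' \<in> carrier M"
  shows "\<pi> (x, y) = \<pi> (x', y') \<longleftrightarrow> (\<exists>a\<in>A. x = x' \<otimes>\<^bsub>L\<^esub> a \<and> y = y' \<otimes>\<^bsub>M\<^esub> inv\<^bsub>M\<^esub> (\<phi> a))"
proof -
  have "\<pi> (inv\<^bsub>L \<times>\<times> M\<^esub> (x', y') \<otimes>\<^bsub>L \<times>\<times> M\<^esub> (x, y)) = inv\<^bsub>K\<^esub> \<pi> (x', y') \<otimes>\<^bsub>K\<^esub> \<pi> (x, y)"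
    using assms hom_inv[of "(x', y')"] by (subst hom_mult) (auto simp: inv_DirProd[OF L.is_group M.is_group])
  moreover have "\<pi> (x, y) = \<pi> (x', y') \<longleftrightarrow> inv\<^bsub>K\<^esub> \<pi> (x', y') \<otimes>\<^bsub>K\<^esub> \<pi> (x, y) = \<one>\<^bsub>K\<^esub>"
    using K.inv_solve_left'[of "\<one>\<^bsub>K\<^esub>" "\<pi> (x', y')" "\<pi> (x, y)"] assms by auto
  ultimately have "\<pi> (x, y) = \<pi> (x', y') \<longleftrightarrow> \<pi> (inv\<^bsub>L \<times>\<times> M\<^esub> (x', y') \<otimes>\<^bsub>L \<times>\<times> M\<^esub> (x, y)) = \<one>\<^bsub>K\<^esub>"
    by simp
  also have "\<dots> \<longleftrightarrow> (inv\<^bsub>L\<^esub> x' \<otimes>\<^bsub>L\<^esub> x, inv\<^bsub>M\<^esub> y' \<otimes>\<^bsub>M\<^esub> y) \<in> kernel (L \<times>\<times> M) K \<pi>"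
    using assms L.is_group M.is_group by (simp add: kernel_def)
  also have "\<dots> \<longleftrightarrow> (\<exists>a\<in>A. inv\<^bsub>L\<^esub> x' \<otimes>\<^bsub>L\<^esub> x = a \<and> inv\<^bsub>M\<^esub> y' \<otimes>\<^bsub>M\<^esub> y = inv\<^bsub>M\<^esub> (\<phi> a))"
    by (auto simp: kernel)
  also have "\<dots> \<longleftrightarrow> (\<exists>a\<in>A. x = x' \<otimes>\<^bsub>L\<^esub> a \<and> y = y' \<otimes>\<^bsub>M\<^esub> inv\<^bsub>M\<^esub> (\<phi> a))"
  proof (rule bex_cong[OF HOL.refl])
    fix a assume "a \<in> A"
    thus "(inv\<^bsub>L\<^esub> x' \<otimes>\<^bsub>L\<^esub> x = a \<and> inv\<^bsub>M\<^esub> y' \<otimes>\<^bsub>M\<^esub> y = inv\<^bsub>M\<^esub> (\<phi> a)) \<longleftrightarrow>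
        (x = x' \<otimes>\<^bsub>L\<^esub> a \<and> y = y' \<otimes>\<^bsub>M\<^esub> inv\<^bsub>M\<^esub> (\<phi> a))"
      using L.inv_solve_left'[of a x' x] M.inv_solve_left'[of "inv\<^bsub>M\<^esub> (\<phi> a)" y' y] A_carrier[of a] assms
      by blast
  qed
  finally show ?thesis .
qed

lemma card_vimage_\<pi>: "finite S \<Longrightarrow> S \<subseteq> carrier K \<Longrightarrow> card {t \<in> carrier (L \<times>\<times> M). \<pi> t \<in> S} = p * card S"
  by (rule card_vimage_surj[OF surj card_kernel])

lemma finite_carrier:
  assumes "finite (carrier L)" "finite (carrier M)"
  shows "finite (carrier K)"
  using assms surj finite_imageI[of "carrier L \<times> carrier M" \<pi>] by simp

lemma order_eq:
  assumes "finite (carrier L)" "finite (carrier M)"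
  shows "order L * order M = p * order K"
proof -
  have "finite (carrier K)" using assms by (rule finite_carrier)
  moreover have "{t \<in> carrier (L \<times>\<times> M). \<pi> t \<in> carrier K} = carrier L \<times> carrier M" by auto
  ultimately show ?thesis using card_vimage_\<pi>[of "carrier K"] by (simp add: order_def card_cartesian_product)
qed

lemma carrier_KE:
  assumes "u \<in> carrier K"
  obtains x y where "x \<in> carrier L" "y \<in> carrier M" "u = \<pi> (x, y)"
proof -
  have "u \<in> \<pi> ` (carrier L \<times> carrier M)" using assms surj by simp
  thus ?thesis using that by blast
qed

lemma \<pi>_pow: "x \<in> carrier L \<Longrightarrow> y \<in> carrier M \<Longrightarrow> \<pi> (x, y) [^]\<^bsub>K\<^esub> (m::nat) = \<pi> (x [^]\<^bsub>L\<^esub> m, y [^]\<^bsub>M\<^esub> m)"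
  using hom_nat_pow[of "(x, y)" m] by (simp add: DirProd_nat_pow)

lemma exponent:
  assumes "\<forall>x\<in>carrier L. x [^]\<^bsub>L\<^esub> m = \<one>\<^bsub>L\<^esub>" "\<forall>x\<in>carrier M. x [^]\<^bsub>M\<^esub> (m::nat) = \<one>\<^bsub>M\<^esub>"
  shows "\<forall>u\<in>carrier K. u [^]\<^bsub>K\<^esub> m = \<one>\<^bsub>K\<^esub>"
proof
  fix u assume "u \<in> carrier K"
  then obtain x y where "x \<in> carrier L" "y \<in> carrier M" "u = \<pi> (x, y)" by (rule carrier_KE)
  thus "u [^]\<^bsub>K\<^esub> m = \<one>\<^bsub>K\<^esub>" using assms hom_one by (simp add: \<pi>_pow)
qed

lemma card_roots:
  assumes fin: "finite (carrier L)" "finite (carrier M)"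
    and x: "x \<in> carrier L" and y: "y \<in> carrier M"
  shows "p * card (roots K m (\<pi> (x, y))) =
    (\<Sum>a\<in>A. card (roots L m (x \<otimes>\<^bsub>L\<^esub> a)) * card (roots M m (y \<otimes>\<^bsub>M\<^esub> inv\<^bsub>M\<^esub> (\<phi> a))))"
proof -
  let ?S = "\<lambda>a. roots L m (x \<otimes>\<^bsub>L\<^esub> a) \<times> roots M m (y \<otimes>\<^bsub>M\<^esub> inv\<^bsub>M\<^esub> (\<phi> a))"
  have finA: "finite A" using fin A_carrier by (meson finite_subset subsetI)
  have fr: "finite (roots L m u)" "finite (roots M m v)" for u v
    using fin by (auto simp: roots_def)
  have "{t \<in> carrier (L \<times>\<times> M). \<pi> t \<in> roots K m (\<pi> (x, y))} = (\<Union>a\<in>A. ?S a)"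
  proof -
    have "\<pi> (g, h) \<in> roots K m (\<pi> (x, y)) \<longleftrightarrow> (g, h) \<in> (\<Union>a\<in>A. ?S a)"
      if "g \<in> carrier L" "h \<in> carrier M" for g h
      using that x y by (simp add: roots_def \<pi>_pow \<pi>_eq_iff)
    thus ?thesis by (auto simp: roots_def)
  qed
  moreover have "card (\<Union>a\<in>A. ?S a) = (\<Sum>a\<in>A. card (?S a))"
  proof (rule card_UN_disjoint[OF finA])
    \<comment> \<open>The first component determines its piece: \<open>g [^] m = x a\<close> fixes
      \<open>a\<close> by cancellation.\<close>
    show "\<forall>i\<in>A. \<forall>j\<in>A. i \<noteq> j \<longrightarrow> ?S i \<inter> ?S j = {}"
      using x A_carrier by (auto simp: roots_def)
  qed (use fr in auto)
  moreover have "roots K m (\<pi> (x, y)) \<subseteq> carrier K" by (auto simp: roots_def)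
  ultimately show ?thesis
    using card_vimage_\<pi>[of "roots K m (\<pi> (x, y))"] finite_subset[OF _ finite_carrier[OF fin]]
    by (simp add: card_cartesian_product)
qed

text \<open>No new central elements arise: commuting \<open>\<pi> (x, y)\<close> with
  \<open>\<pi> (g, 1)\<close> produces an amalgamated pair with trivial second component, and
  injectivity of \<open>\<phi>\<close> makes the whole pair trivial. For \<open>\<pi> (1, h)\<close>
  the first component is trivial, which suffices at once.\<close>

lemma center_K_iff:
  assumes x: "x \<in> carrier L" and y: "y \<in> carrier M"
  shows "\<pi> (x, y) \<in> group_center K \<longleftrightarrow> x \<in> group_center L \<and> y \<in> group_center M"
proof
  assume c: "\<pi> (x, y) \<in> group_center K"
  have "x \<otimes>\<^bsub>L\<^esub> g = g \<otimes>\<^bsub>L\<^esub> x \<and> y \<otimes>\<^bsub>M\<^esub> h = h \<otimes>\<^bsub>M\<^esub> y"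
    if g: "g \<in> carrier L" and h: "h \<in> carrier M" for g h
  proof -
    have "\<pi> (x, y) \<otimes>\<^bsub>K\<^esub> \<pi> (g, \<one>\<^bsub>M\<^esub>) = \<pi> (g, \<one>\<^bsub>M\<^esub>) \<otimes>\<^bsub>K\<^esub> \<pi> (x, y)"
      "\<pi> (x, y) \<otimes>\<^bsub>K\<^esub> \<pi> (\<one>\<^bsub>L\<^esub>, h) = \<pi> (\<one>\<^bsub>L\<^esub>, h) \<otimes>\<^bsub>K\<^esub> \<pi> (x, y)"
      using c g h by (auto simp: group_center_def)
    hence "\<pi> (x \<otimes>\<^bsub>L\<^esub> g, y) = \<pi> (g \<otimes>\<^bsub>L\<^esub> x, y)" "\<pi> (x, y \<otimes>\<^bsub>M\<^esub> h) = \<pi> (x, h \<otimes>\<^bsub>M\<^esub> y)"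
      using x y g h by (simp_all add: hom_mult[symmetric] del: hom_mult)
    then obtain a b where a: "a \<in> A" "x \<otimes>\<^bsub>L\<^esub> g = g \<otimes>\<^bsub>L\<^esub> x \<otimes>\<^bsub>L\<^esub> a" "y = y \<otimes>\<^bsub>M\<^esub> inv\<^bsub>M\<^esub> (\<phi> a)"
      and b: "b \<in> A" "x = x \<otimes>\<^bsub>L\<^esub> b" "y \<otimes>\<^bsub>M\<^esub> h = h \<otimes>\<^bsub>M\<^esub> y \<otimes>\<^bsub>M\<^esub> inv\<^bsub>M\<^esub> (\<phi> b)"
      using x y g h by (auto simp: \<pi>_eq_iff)
    have "inv\<^bsub>M\<^esub> (\<phi> a) = \<one>\<^bsub>M\<^esub>" using a y A_carrier M.r_cancel_one' M.l_cancel_one' M.inv_closed by metis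
    hence "\<phi> a = \<phi> \<one>\<^bsub>L\<^esub>" using A_carrier[OF a(1)] \<phi>(3) by simp
    hence "a = \<one>\<^bsub>L\<^esub>" using a A \<phi>(1) by (auto dest: inj_onD)
    moreover have "b = \<one>\<^bsub>L\<^esub>" using b x A_carrier L.l_cancel_one' by metis
    ultimately show ?thesis using a b x y g h \<phi>(3) by simp
  qed
  thus "x \<in> group_center L \<and> y \<in> group_center M" using x y by (auto simp: group_center_def)
next
  assume c: "x \<in> group_center L \<and> y \<in> group_center M"
  have "\<pi> (x, y) \<otimes>\<^bsub>K\<^esub> u = u \<otimes>\<^bsub>K\<^esub> \<pi> (x, y)" if u: "u \<in> carrier K" for u
  proof -
    obtain g h where gh: "g \<in> carrier L" "h \<in> carrier M" "u = \<pi> (g, h)" using u by (auto elim: carrier_KE)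
    hence "x \<otimes>\<^bsub>L\<^esub> g = g \<otimes>\<^bsub>L\<^esub> x" "y \<otimes>\<^bsub>M\<^esub> h = h \<otimes>\<^bsub>M\<^esub> y" using c group_centerD by metis+
    thus ?thesis using gh x y by (simp add: hom_mult[symmetric] del: hom_mult)
  qed
  thus "\<pi> (x, y) \<in> group_center K" using x y by (auto simp: group_center_def)
qed

text \<open>The preimage of the center is the product of the two centers. If both have order
  \<open>p\<close>, the center of \<open>K\<close> has order \<open>p\<close> again.\<close>

lemma card_center:
  assumes fin: "finite (carrier L)" "finite (carrier M)"
  shows "card (group_center L) * card (group_center M) = p * card (group_center K)"
proof -
  have "finite (group_center K)"
    using finite_carrier[OF fin] by (rule finite_subset[rotated]) (auto simp: group_center_def)
  moreover have "{t \<in> carrier (L \<times>\<times> M). \<pi> t \<in> group_center K} = group_center L \<times> group_center M"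
    using center_K_iff by (auto simp: group_center_def[of L] group_center_def[of M])
  moreover have "group_center K \<subseteq> carrier K" by (auto simp: group_center_def)
  ultimately show ?thesis using card_vimage_\<pi>[of "group_center K"] by (simp add: card_cartesian_product)
qed

end

section \<open>Counting elements by order\<close>

text \<open>The identity is among the \<open>c\<close> solutions, which is where the
  \<open>c - 1\<close> in the counts comes from.\<close>

definition has_profile :: "nat \<Rightarrow> nat \<Rightarrow> nat \<Rightarrow> ('a, 'b) monoid_scheme \<Rightarrow> bool" where
  "has_profile p N c G \<longleftrightarrow> group G \<and> finite (carrier G) \<and> order G = N \<and>
     (\<forall>x\<in>carrier G. x [^]\<^bsub>G\<^esub> (p ^ 2) = \<one>\<^bsub>G\<^esub>) \<and> card (roots G p \<one>\<^bsub>G\<^esub>) = c"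

lemma (in group) has_profile_exponent:
  assumes "finite (carrier G)" "order G = N" "\<forall>x\<in>carrier G. x [^] (p::nat) = \<one>"
  shows "has_profile p N N G"
proof -
  have "roots G p \<one> = carrier G" using assms by (auto simp: roots_def)
  moreover have "x [^] (p ^ 2) = \<one>" if "x \<in> carrier G" for x
    using that assms nat_pow_pow[of x p p] by (simp add: power2_eq_square)
  ultimately show ?thesis using assms is_group by (simp add: has_profile_def order_def)
qed

lemma has_profile_iso:
  assumes "G \<cong> H" "group G" "has_profile p N c H"
  shows "has_profile p N c G"
proof -
  have H: "group H" using assms by (simp add: has_profile_def)
  obtain h where h: "group_hom G H h" "bij_betw h (carrier G) (carrier H)"
    by (rule is_isoE[OF assms(1,2) H])
  interpret group_hom G H h by (rule h)
  have eq: "x [^]\<^bsub>G\<^esub> (m::nat) = \<one>\<^bsub>G\<^esub> \<longleftrightarrow> h x [^]\<^bsub>H\<^esub> m = \<one>\<^bsub>H\<^esub>" if "x \<in> carrier G" for x m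
    using that inj_on_eq_iff[OF bij_betw_imp_inj_on[OF h(2)], of "x [^]\<^bsub>G\<^esub> m" "\<one>\<^bsub>G\<^esub>"]
    by (simp add: hom_nat_pow)
  have "bij_betw h (roots G p \<one>\<^bsub>G\<^esub>) (roots H p \<one>\<^bsub>H\<^esub>)"
  proof (rule bij_betw_subset[OF h(2)])
    show "h ` roots G p \<one>\<^bsub>G\<^esub> = roots H p \<one>\<^bsub>H\<^esub>"
    proof (rule equalityI; rule subsetI)
      fix y assume "y \<in> roots H p \<one>\<^bsub>H\<^esub>"
      moreover from this obtain x where "x \<in> carrier G" "y = h x"
        using bij_betw_imp_surj_on[OF h(2)] by (auto simp: roots_def)
      ultimately show "y \<in> h ` roots G p \<one>\<^bsub>G\<^esub>" using eq[of x p] by (auto simp: roots_def)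
    qed (use eq in \<open>auto simp: roots_def\<close>)
  qed (auto simp: roots_def)
  hence "card (roots G p \<one>\<^bsub>G\<^esub>) = c" using assms(3) bij_betw_same_card by (force simp: has_profile_def)
  moreover have "x [^]\<^bsub>G\<^esub> (p ^ 2) = \<one>\<^bsub>G\<^esub>" if "x \<in> carrier G" for x
    using that eq assms(3) by (simp add: has_profile_def)
  ultimately show ?thesis
    using assms(2,3) bij_betw_same_card[OF h(2)] bij_betw_finite[OF h(2)]
    by (simp add: has_profile_def order_def)
qed

lemma has_profile_DirProd:
  assumes "has_profile p N c G" "has_profile p N' c' H"
  shows "has_profile p (N * N') (c * c') (G \<times>\<times> H)"
proof -
  have "roots (G \<times>\<times> H) p \<one>\<^bsub>G \<times>\<times> H\<^esub> = roots G p \<one>\<^bsub>G\<^esub> \<times> roots H p \<one>\<^bsub>H\<^esub>"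
    by (auto simp: roots_def DirProd_nat_pow)
  thus ?thesis
    using assms by (auto simp: has_profile_def DirProd_group DirProd_nat_pow order_def card_cartesian_product)
qed

lemma product_group_nat_pow:
  assumes "\<And>i. i \<in> I \<Longrightarrow> group (H i)" "x \<in> carrier (product_group I H)"
  shows "x [^]\<^bsub>product_group I H\<^esub> (m::nat) = (\<lambda>i\<in>I. x i [^]\<^bsub>H i\<^esub> m)"
  using assms by (induction m) (auto simp: fun_eq_iff restrict_def)

text \<open>Elements are extensional functions on \<open>{..<k}\<close>, so for \<open>k = 0\<close>
  there is exactly one and the profile is that of the trivial group.\<close>

lemma has_profile_cyclic_power:
  assumes "p > 0"
  shows "has_profile p (p ^ k) (p ^ k) (cyclic_power p k)"
proof (rule group.has_profile_exponent)
  show "group (cyclic_power p k)" by simp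
  have C: "carrier (cyclic_power p k) = (\<Pi>\<^sub>E i\<in>{..<k}. {0..<int p})"
    using assms by (simp add: carrier_integer_mod_group)
  show "finite (carrier (cyclic_power p k))" unfolding C by (rule finite_PiE) auto
  show "order (cyclic_power p k) = p ^ k" unfolding order_def C by (simp add: card_PiE)
  show "\<forall>x\<in>carrier (cyclic_power p k). x [^]\<^bsub>cyclic_power p k\<^esub> p = \<one>\<^bsub>cyclic_power p k\<^esub>"
  proof
    fix x assume "x \<in> carrier (cyclic_power p k)"
    thus "x [^]\<^bsub>cyclic_power p k\<^esub> p = \<one>\<^bsub>cyclic_power p k\<^esub>"
      by (subst product_group_nat_pow) auto
  qed
qed

text \<open>Element orders divide \<open>p ^ 2\<close>: the order is \<open>p ^ 2\<close> off the
  set of \<open>p\<close>-th roots of the identity, and \<open>p\<close> on that set except at the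
  identity itself. The truncated subtractions are exact because this set contains the identity and
  lies in the carrier.\<close>

lemma has_profile_counts:
  assumes p: "prime p" and prof: "has_profile p N c G"
  shows "num_of_order p G = c - 1" "num_of_order (p ^ 2) G = N - c"
    "psi G = p ^ 2 * (N - c) + p * (c - 1) + 1"
proof -
  interpret group G using prof by (simp add: has_profile_def)
  have fin: "finite (carrier G)" and N: "card (carrier G) = N" and c: "card (roots G p \<one>\<^bsub>G\<^esub>) = c"
    and ex: "\<And>x. x \<in> carrier G \<Longrightarrow> x [^]\<^bsub>G\<^esub> (p ^ 2) = \<one>\<^bsub>G\<^esub>"
    using prof by (auto simp: has_profile_def order_def)
  let ?R = "roots G p \<one>\<^bsub>G\<^esub>"
  have R: "?R \<subseteq> carrier G" "\<one>\<^bsub>G\<^esub> \<in> ?R" "finite ?R"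
    using fin by (auto simp: roots_def)
  have R_iff: "x \<in> ?R \<longleftrightarrow> x \<in> carrier G \<and> ord x dvd p" for x
    by (auto simp: roots_def pow_eq_id)
  have p1: "p \<noteq> 1" "p ^ 2 \<noteq> 1" "p ^ 2 \<noteq> p"
    using prime_gt_1_nat[OF p] by (auto simp: power2_eq_square)
  have ord_R: "x \<in> carrier G \<Longrightarrow> ord x = p \<longleftrightarrow> x \<in> ?R - {\<one>\<^bsub>G\<^esub>}" for x
    using p p1 ord_eq_1[of x] by (auto simp: R_iff prime_nat_iff)
  have ord_R': "x \<in> carrier G \<Longrightarrow> ord x = p ^ 2 \<longleftrightarrow> x \<in> carrier G - ?R" for x
  proof -
    assume x: "x \<in> carrier G"
    hence "ord x dvd p ^ 2" using ex pow_eq_id by blast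
    then obtain i where i: "i \<le> 2" "ord x = p ^ i" using divides_primepow_nat[OF p] by blast
    moreover have "i = 0 \<or> i = 1 \<or> i = 2" using i(1) by auto
    moreover have "\<not> p ^ 2 dvd p" using p by (simp add: power2_eq_square prime_nat_iff)
    ultimately show "ord x = p ^ 2 \<longleftrightarrow> x \<in> carrier G - ?R"
      using x p1 by (auto simp: R_iff)
  qed
  have "{x \<in> carrier G. ord x = p} = ?R - {\<one>\<^bsub>G\<^esub>}" using ord_R R by auto
  thus "num_of_order p G = c - 1" using R c by (simp add: num_of_order_def)
  have "{x \<in> carrier G. ord x = p ^ 2} = carrier G - ?R" using ord_R' R by auto
  thus "num_of_order (p ^ 2) G = N - c" using R c N by (simp add: num_of_order_def card_Diff_subset)
  have "psi G = (\<Sum>x\<in>carrier G - ?R. ord x) + (\<Sum>x\<in>?R. ord x)"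
    using sum.subset_diff[OF R(1) fin] by (simp add: psi_def)
  also have "(\<Sum>x\<in>carrier G - ?R. ord x) = (\<Sum>x\<in>carrier G - ?R. p ^ 2)"
    using ord_R' by (intro sum.cong) auto
  also have "\<dots> = p ^ 2 * (N - c)" using R c N by (simp add: card_Diff_subset)
  also have "(\<Sum>x\<in>?R. ord x) = 1 + (\<Sum>x\<in>?R - {\<one>\<^bsub>G\<^esub>}. ord x)"
    using sum.remove[OF R(3,2), of "\<lambda>x. ord x"] by simp
  also have "(\<Sum>x\<in>?R - {\<one>\<^bsub>G\<^esub>}. ord x) = (\<Sum>x\<in>?R - {\<one>\<^bsub>G\<^esub>}. p)"
    using ord_R R by (intro sum.cong) auto
  also have "\<dots> = p * (c - 1)" using R c by simp
  finally show "psi G = p ^ 2 * (N - c) + p * (c - 1) + 1" by simp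
qed

text \<open>The invariant of the central powers of the modular group: every central element has the same
  number of \<open>p\<close>-th roots. It survives central products because the center has order \<open>p\<close>, so that
  all of it is amalgamated.\<close>

definition central_roots :: "nat \<Rightarrow> nat \<Rightarrow> ('a, 'b) monoid_scheme \<Rightarrow> bool" where
  "central_roots p n G \<longleftrightarrow> group G \<and> finite (carrier G) \<and> order G = p ^ (2 * n + 1) \<and>
     (\<forall>x\<in>carrier G. x [^]\<^bsub>G\<^esub> (p ^ 2) = \<one>\<^bsub>G\<^esub>) \<and> card (group_center G) = p \<and>
     (\<forall>u\<in>group_center G. card (roots G p u) = p ^ (2 * n))"

lemma central_roots_profile:
  assumes "central_roots p n G"
  shows "has_profile p (p ^ (2 * n + 1)) (p ^ (2 * n)) G"
proof -
  interpret group G using assms by (simp add: central_roots_def)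
  have "\<one>\<^bsub>G\<^esub> \<in> group_center G" using subgroup_group_center by (rule subgroup.one_closed)
  thus ?thesis using assms by (simp add: central_roots_def has_profile_def)
qed

lemma central_roots_central_product:
  assumes L: "central_roots p n L" and M: "central_roots p m M" and K: "is_central_product p L M K"
    and p: "p > 0"
  shows "central_roots p (n + m) K"
proof -
  have gr: "group L" "group M" using L M by (auto simp: central_roots_def)
  obtain A \<phi> \<pi> where "central_product p L M K A \<phi> \<pi>" by (rule central_productE[OF K gr])
  then interpret central_product p L M K A \<phi> \<pi> .
  have fin: "finite (carrier L)" "finite (carrier M)" using L M by (auto simp: central_roots_def)
  \<comment> \<open>The exponents add up to \<open>2 * (n + m) + 2\<close>; amalgamation removes one
    factor \<open>p\<close>.\<close>
  have "p * order K = p * p ^ (2 * (n + m) + 1)"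
    using order_eq[OF fin, symmetric] L M by (simp add: central_roots_def power_add algebra_simps)
  hence order: "order K = p ^ (2 * (n + m) + 1)" using p by (metis mult_left_cancel less_not_refl)
  have center: "card (group_center K) = p"
    using card_center[OF fin] L M p by (simp add: central_roots_def)
  have "card (roots K p u) = p ^ (2 * (n + m))" if u: "u \<in> group_center K" for u
  proof -
    obtain x y where xy: "x \<in> carrier L" "y \<in> carrier M" "u = \<pi> (x, y)"
      using carrier_KE[OF group_centerD(1)[OF u]] by blast
    hence c: "x \<in> group_center L" "y \<in> group_center M" using u center_K_iff by auto
    \<comment> \<open>Multiplication by amalgamated elements keeps both targets central, so all
      \<open>p\<close> summands are equal; the factor \<open>p\<close> then cancels.\<close>
    have "p * card (roots K p u) = (\<Sum>a\<in>A. p ^ (2 * n) * p ^ (2 * m))"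
      unfolding xy(3) card_roots[OF fin xy(1,2)]
    proof (rule sum.cong[OF HOL.refl])
      fix a assume a: "a \<in> A"
      have "x \<otimes>\<^bsub>L\<^esub> a \<in> group_center L"
        using subgroup.m_closed[OF L.subgroup_group_center c(1)] a A(1) by blast
      moreover have "y \<otimes>\<^bsub>M\<^esub> inv\<^bsub>M\<^esub> (\<phi> a) \<in> group_center M"
        using subgroup.m_closed[OF M.subgroup_group_center c(2)]
          subgroup.m_inv_closed[OF M.subgroup_group_center] a \<phi>(2) by blast
      ultimately show "card (roots L p (x \<otimes>\<^bsub>L\<^esub> a)) * card (roots M p (y \<otimes>\<^bsub>M\<^esub> inv\<^bsub>M\<^esub> (\<phi> a))) =
          p ^ (2 * n) * p ^ (2 * m)"
        using L M by (simp add: central_roots_def)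
    qed
    hence "p * card (roots K p u) = p * p ^ (2 * (n + m))"
      using A(2) by (simp add: power_add[symmetric] algebra_simps)
    thus ?thesis using p by simp
  qed
  thus ?thesis
    using order center K.is_group finite_carrier[OF fin] exponent[of "p ^ 2"] L M
    by (simp add: central_roots_def)
qed

lemma exponent_central_product:
  assumes L: "group L" "finite (carrier L)" "order L = p ^ (2 * n + 1)" "\<forall>x\<in>carrier L. x [^]\<^bsub>L\<^esub> p = \<one>\<^bsub>L\<^esub>"
    and M: "group M" "finite (carrier M)" "order M = p ^ (2 * m + 1)" "\<forall>x\<in>carrier M. x [^]\<^bsub>M\<^esub> p = \<one>\<^bsub>M\<^esub>"
    and K: "is_central_product p L M K" and p: "p > 0"
  shows "group K \<and> finite (carrier K) \<and> order K = p ^ (2 * (n + m) + 1) \<and>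
    (\<forall>x\<in>carrier K. x [^]\<^bsub>K\<^esub> p = \<one>\<^bsub>K\<^esub>)"
proof -
  obtain A \<phi> \<pi> where "central_product p L M K A \<phi> \<pi>" by (rule central_productE[OF K L(1) M(1)])
  then interpret central_product p L M K A \<phi> \<pi> .
  have "p * order K = p * p ^ (2 * (n + m) + 1)"
    using order_eq[OF L(2) M(2), symmetric] L M by (simp add: power_add algebra_simps)
  hence "order K = p ^ (2 * (n + m) + 1)" using p by (metis mult_left_cancel less_not_refl)
  thus ?thesis using exponent[OF L(4) M(4)] finite_carrier[OF L(2) M(2)] K.is_group by blast
qed

text \<open>In \<open>L\<close> only the identity has \<open>p\<close>-th roots, namely all
  \<open>N\<close> elements. So just \<open>a = 1\<close> contributes to the sum over the
  amalgamated subgroup, with \<open>N\<close> times the \<open>p\<close> roots in the cyclic factor,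
  and dividing by \<open>p\<close> leaves \<open>N\<close>.\<close>

lemma has_profile_central_product_cyclic:
  assumes L: "group L" "finite (carrier L)" "order L = N" "\<forall>x\<in>carrier L. x [^]\<^bsub>L\<^esub> p = \<one>\<^bsub>L\<^esub>"
    and K: "is_central_product p L (integer_mod_group (p ^ 2)) K" and p: "p > 0"
  shows "has_profile p (p * N) N K"
proof -
  let ?Z = "integer_mod_group (p ^ 2)"
  have "group ?Z" by simp
  then obtain A \<phi> \<pi> where "central_product p L ?Z K A \<phi> \<pi>" by (rule central_productE[OF K L(1)])
  then interpret central_product p L ?Z K A \<phi> \<pi> .
  have Z: "carrier ?Z = {0..<int (p ^ 2)}" using p by (simp add: carrier_integer_mod_group)
  have fin: "finite (carrier ?Z)" unfolding Z by simp
  have "p * order K = p * (p * N)"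
    using order_eq[OF L(2) fin, symmetric] L(3)
    by (simp only: order_def Z card_atLeastLessThan_int) (simp add: power2_eq_square nat_mult_distrib)
  hence order: "order K = p * N" using p by simp
  have roots_L: "roots L p u = (if u = \<one>\<^bsub>L\<^esub> then carrier L else {})" for u
    using L(4) by (auto simp: roots_def)
  have roots_Z: "card (roots ?Z p \<one>\<^bsub>?Z\<^esub>) = p"
  proof -
    \<comment> \<open>The cyclic group is additive: \<open>p x\<close> vanishes modulo
      \<open>p ^ 2\<close> exactly for the multiples of \<open>p\<close>, of which there are
      \<open>p\<close>.\<close>
    have "roots ?Z p \<one>\<^bsub>?Z\<^esub> = (\<lambda>i. int p * i) ` {0..<int p}"
    proof (rule equalityI; rule subsetI)
      fix x assume "x \<in> roots ?Z p \<one>\<^bsub>?Z\<^esub>"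
      hence x: "0 \<le> x" "x < int p * int p" "int p * int p dvd int p * x"
        using Z by (auto simp: roots_def power2_eq_square mod_eq_0_iff_dvd)
      hence "int p dvd x" using p by simp
      then obtain i where "x = int p * i" by (elim dvdE)
      thus "x \<in> (\<lambda>i. int p * i) ` {0..<int p}"
        using x p by (auto simp: zero_le_mult_iff)
    next
      fix x assume "x \<in> (\<lambda>i. int p * i) ` {0..<int p}"
      thus "x \<in> roots ?Z p \<one>\<^bsub>?Z\<^esub>"
        using p Z by (auto simp: roots_def power2_eq_square mod_eq_0_iff_dvd)
    qed
    thus ?thesis using p by (simp add: card_image inj_on_def)
  qed
  have "p * card (roots K p \<one>\<^bsub>K\<^esub>) = p * card (roots K p (\<pi> (\<one>\<^bsub>L\<^esub>, \<one>\<^bsub>?Z\<^esub>)))"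
    using hom_one by simp
  also have "\<dots> = (\<Sum>a\<in>A. card (roots L p (\<one>\<^bsub>L\<^esub> \<otimes>\<^bsub>L\<^esub> a)) *
      card (roots ?Z p (\<one>\<^bsub>?Z\<^esub> \<otimes>\<^bsub>?Z\<^esub> inv\<^bsub>?Z\<^esub> (\<phi> a))))"
    by (rule card_roots[OF L(2) fin L.one_closed M.one_closed])
  also have "\<dots> = (\<Sum>a\<in>A. if a = \<one>\<^bsub>L\<^esub> then N * p else 0)"
  proof (rule sum.cong[OF HOL.refl])
    fix a assume a: "a \<in> A"
    have "\<one>\<^bsub>?Z\<^esub> \<otimes>\<^bsub>?Z\<^esub> inv\<^bsub>?Z\<^esub> \<one>\<^bsub>?Z\<^esub> = \<one>\<^bsub>?Z\<^esub>" by (rule M.r_inv[OF M.one_closed])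
    thus "card (roots L p (\<one>\<^bsub>L\<^esub> \<otimes>\<^bsub>L\<^esub> a)) * card (roots ?Z p (\<one>\<^bsub>?Z\<^esub> \<otimes>\<^bsub>?Z\<^esub> inv\<^bsub>?Z\<^esub> (\<phi> a))) =
      (if a = \<one>\<^bsub>L\<^esub> then N * p else 0)"
      using A_carrier(1)[OF a] L(3) \<phi>(3) roots_Z by (auto simp: roots_L order_def)
  qed
  also have "\<dots> = N * p"
  proof -
    have "finite A" using A(2) p card_ge_0_finite by blast
    thus ?thesis using A(3) by simp
  qed
  finally have "card (roots K p \<one>\<^bsub>K\<^esub>) = N" using p by simp
  moreover have "\<forall>u\<in>carrier K. u [^]\<^bsub>K\<^esub> (p ^ 2) = \<one>\<^bsub>K\<^esub>"
  proof (rule exponent)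
    show "\<forall>x\<in>carrier L. x [^]\<^bsub>L\<^esub> (p ^ 2) = \<one>\<^bsub>L\<^esub>"
    proof
      fix x assume x: "x \<in> carrier L"
      thus "x [^]\<^bsub>L\<^esub> (p ^ 2) = \<one>\<^bsub>L\<^esub>"
        using L(4) L.nat_pow_pow[OF x, of p p] by (simp add: power2_eq_square)
    qed
  qed simp
  ultimately show ?thesis
    using order K.is_group finite_carrier[OF L(2) fin] by (simp add: has_profile_def)
qed

section \<open>Quotients of the integer Heisenberg group\<close>

text \<open>The triple \<open>(b, a, c)\<close> stands for \<open>y\<^sup>b x\<^sup>a z\<^sup>c\<close>, where \<open>x y = y x z\<close> and \<open>z\<close> is central.\<close>

definition int_heis :: "(int \<times> int \<times> int) monoid" where
  "int_heis = \<lparr>carrier = UNIV,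
     monoid.mult = (\<lambda>(b, a, c) (b', a', c'). (b + b', a + a', c + c' + a * b')),
     one = (0, 0, 0)\<rparr>"

lemma int_heis_simps [simp]:
  "carrier int_heis = UNIV"
  "(b, a, c) \<otimes>\<^bsub>int_heis\<^esub> (b', a', c') = (b + b', a + a', c + c' + a * b')"
  "\<one>\<^bsub>int_heis\<^esub> = (0, 0, 0)"
  by (simp_all add: int_heis_def)

lemma group_int_heis [simp]: "group int_heis"
proof (rule groupI)
  fix t assume "t \<in> carrier int_heis"
  obtain b a c where t: "t = (b, a, c)" by (cases t)
  have "(- b, - a, a * b - c) \<otimes>\<^bsub>int_heis\<^esub> t = \<one>\<^bsub>int_heis\<^esub>" by (simp add: t)
  thus "\<exists>s\<in>carrier int_heis. s \<otimes>\<^bsub>int_heis\<^esub> t = \<one>\<^bsub>int_heis\<^esub>"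
    by (auto intro!: bexI[where x = "(- b, - a, a * b - c)"])
qed (auto simp: algebra_simps)

lemma inv_int_heis [simp]: "inv\<^bsub>int_heis\<^esub> (b, a, c) = (- b, - a, a * b - c)"
  by (rule group.inv_equality) auto

text \<open>Collecting moves the \<open>x\<close> part of each factor past the \<open>y\<close> part
  of each later one, which costs \<open>a * b\<close> in the third coordinate for every pair of
  factors.\<close>

lemma int_heis_pow:
  "(b, a, c) [^]\<^bsub>int_heis\<^esub> (m::nat) = (int m * b, int m * a, int m * c + a * b * int (m choose 2))"
proof (induction m)
  case (Suc m)
  have "Suc m choose 2 = (m choose 2) + m" by (simp add: numeral_2_eq_2)
  thus ?case using Suc by (simp add: algebra_simps)
qed simp

text \<open>With \<open>a * b = 0\<close> the binomial term disappears, also for negative exponents;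
  the three generators are of this kind.\<close>

lemma int_heis_int_pow:
  assumes "a * b = 0"
  shows "(b, a, c) [^]\<^bsub>int_heis\<^esub> (m::int) = (m * b, m * a, m * c)"
  using assms by (cases m rule: int_cases2)
    (auto simp: int_pow_int group.int_pow_neg_int int_heis_pow)

text \<open>For \<open>p > 0\<close>, this is the normal closure of \<open>y^p\<close>,
  \<open>z^p\<close> and \<open>x^p z^(-e)\<close>. If \<open>a = p \<alpha>\<close>, the third
  condition says that \<open>p\<close> divides \<open>e \<alpha> + c\<close>; scaling by
  \<open>p\<close> states this without dividing \<open>a\<close>.\<close>

definition int_heis_kernel :: "nat \<Rightarrow> nat \<Rightarrow> (int \<times> int \<times> int) set" where
  "int_heis_kernel p e =
     {(b, a, c). int p dvd b \<and> int p dvd a \<and> int p * int p dvd int e * a + int p * c}"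

lemma normal_int_heis_kernel: "int_heis_kernel p e \<lhd> int_heis"
  unfolding group.normal_inv_iff[OF group_int_heis]
proof safe
  show "subgroup (int_heis_kernel p e) int_heis"
  proof
    fix s t assume "s \<in> int_heis_kernel p e" "t \<in> int_heis_kernel p e"
    moreover obtain b a c b' a' c' where "s = (b, a, c)" "t = (b', a', c')" by (metis surj_pair)
    \<comment> \<open>The linear form is additive up to the term from \<open>a * b'\<close>, and
      \<open>p\<close> divides \<open>b'\<close>.\<close>
    moreover have "int e * (a + a') + int p * (c + c' + a * b') =
        (int e * a + int p * c) + (int e * a' + int p * c') + int p * (a * b')"
      by (simp add: algebra_simps)
    ultimately show "s \<otimes>\<^bsub>int_heis\<^esub> t \<in> int_heis_kernel p e"
      by (auto simp: int_heis_kernel_def)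
  next
    fix s assume "s \<in> int_heis_kernel p e"
    moreover obtain b a c where "s = (b, a, c)" by (metis surj_pair)
    moreover have "int p * int p dvd int e * - a + int p * (a * b - c)"
      if "int p dvd a" "int p * int p dvd int e * a + int p * c"
    proof -
      have "int p * int p dvd int p * (a * b) - (int e * a + int p * c)"
        using that by (intro dvd_diff mult_dvd_mono) auto
      thus ?thesis by (simp add: algebra_simps)
    qed
    ultimately show "inv\<^bsub>int_heis\<^esub> s \<in> int_heis_kernel p e"
      by (auto simp: int_heis_kernel_def)
  qed (auto simp: int_heis_kernel_def)
next
  fix b a c b' a' c' assume "(b', a', c') \<in> int_heis_kernel p e"
  \<comment> \<open>Conjugation changes the third coordinate by \<open>a * b' - a' * b\<close>, a
    multiple of \<open>p\<close> on the kernel.\<close>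
  moreover have "int p * int p dvd int e * a' + int p * (c + c' + a * b' + (a * b - c) - (a + a') * b)"
    if "int p dvd b'" "int p dvd a'" "int p * int p dvd int e * a' + int p * c'"
  proof -
    have "int p * int p dvd int e * a' + int p * c' + int p * (a * b' - a' * b)"
      using that by (intro dvd_add[OF that(3)] mult_dvd_mono) auto
    thus ?thesis by (simp add: algebra_simps)
  qed
  ultimately show "(b, a, c) \<otimes>\<^bsub>int_heis\<^esub> (b', a', c') \<otimes>\<^bsub>int_heis\<^esub> inv\<^bsub>int_heis\<^esub> (b, a, c) \<in> int_heis_kernel p e"
    by (auto simp: int_heis_kernel_def)
qed

text \<open>\<open>K\<close> is the quotient of the integer Heisenberg group by the relations \<open>y\<^sup>p = z\<^sup>p = 1\<close> and
  \<open>x\<^sup>p = z\<^sup>e\<close>: this is the Heisenberg group modulo \<open>p\<close> for \<open>e = 0\<close>, and the modular group of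
  order \<open>p\<^sup>3\<close>, with \<open>z = x\<^sup>p\<close>, for \<open>e = 1\<close>.\<close>

locale int_heis_quotient =
  group_hom int_heis K F
  for p e :: nat and K :: "('a, 'b) monoid_scheme" and F :: "int \<times> int \<times> int \<Rightarrow> 'a" +
  assumes p: "prime p" "odd p"
    and surj: "range F = carrier K"
    and ker: "\<And>t. F t = \<one>\<^bsub>K\<^esub> \<longleftrightarrow> t \<in> int_heis_kernel p e"
begin

lemma F_in [simp]: "F t \<in> carrier K"
  using hom_closed[of t] by simp

text \<open>Multiplying by an inverse leaves a correction \<open>a' * (b - b')\<close> in the third
  coordinate. It is a multiple of \<open>p\<close> once \<open>p\<close> divides
  \<open>b - b'\<close>, so the test involves only coordinate differences.\<close>

lemma F_eq_iff: "F (b, a, c) = F (b', a', c') \<longleftrightarrow>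
    int p dvd b - b' \<and> int p dvd a - a' \<and> int p * int p dvd int e * (a - a') + int p * (c - c')"
proof -
  have "F (b, a, c) = F (b', a', c') \<longleftrightarrow> inv\<^bsub>K\<^esub> F (b', a', c') \<otimes>\<^bsub>K\<^esub> F (b, a, c) = \<one>\<^bsub>K\<^esub>"
    using H.inv_solve_left'[of "\<one>\<^bsub>K\<^esub>" "F (b', a', c')" "F (b, a, c)"] by auto
  also have "inv\<^bsub>K\<^esub> F (b', a', c') \<otimes>\<^bsub>K\<^esub> F (b, a, c) = F (inv\<^bsub>int_heis\<^esub> (b', a', c') \<otimes>\<^bsub>int_heis\<^esub> (b, a, c))"
    by (subst hom_mult) (simp_all only: hom_inv int_heis_simps UNIV_I)
  also have "F (inv\<^bsub>int_heis\<^esub> (b', a', c') \<otimes>\<^bsub>int_heis\<^esub> (b, a, c)) = \<one>\<^bsub>K\<^esub> \<longleftrightarrow> (b - b', a - a', c - c' - a' * (b - b')) \<in> int_heis_kernel p e"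
    by (simp add: ker algebra_simps)
  also have "\<dots> \<longleftrightarrow> int p dvd b - b' \<and> int p dvd a - a' \<and>
      int p * int p dvd (int e * (a - a') + int p * (c - c')) - int p * (a' * (b - b'))"
    by (simp add: int_heis_kernel_def algebra_simps)
  also have "\<dots> \<longleftrightarrow> int p dvd b - b' \<and> int p dvd a - a' \<and>
      int p * int p dvd int e * (a - a') + int p * (c - c')"
  proof -
    have "int p * int p dvd int p * (a' * (b - b'))" if "int p dvd b - b'"
      using that by (intro mult_dvd_mono) auto
    thus ?thesis by (metis dvd_diff_left_iff dvd_diff dvd_add diff_add_cancel)
  qed
  finally show ?thesis .
qed

text \<open>The normal forms: each element of \<open>K\<close> will have exactly one triple of
  reduced exponents.\<close>

definition box :: "(int \<times> int \<times> int) set" where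
  "box = {0..<int p} \<times> {0..<int p} \<times> {0..<int p}"

lemma residue_eq: "i = j" if "i \<in> {0..<int p}" "j \<in> {0..<int p}" "int p dvd i - j"
  using that by (auto simp: mod_eq_dvd_iff[symmetric])

lemma p_pos: "p > 0"
  using p(1) prime_gt_0_nat by blast

lemma bij_box: "bij_betw F box (carrier K)"
  unfolding bij_betw_def
proof
  show "inj_on F box"
  proof (rule inj_onI)
    fix s t assume st: "s \<in> box" "t \<in> box" "F s = F t"
    obtain b a c b' a' c' where s: "s = (b, a, c)" "t = (b', a', c')" by (metis surj_pair)
    hence "b = b'" "a = a'" using st by (auto simp: box_def F_eq_iff intro!: residue_eq)
    hence "int p * int p dvd int p * (c - c')" using st s by (simp add: F_eq_iff)
    hence "int p dvd c - c'" using p_pos by simp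
    hence "c = c'" using st s by (auto simp: box_def intro!: residue_eq)
    thus "s = t" using s \<open>b = b'\<close> \<open>a = a'\<close> by simp
  qed
  show "F ` box = carrier K"
  proof (rule equalityI; rule subsetI)
    fix u assume "u \<in> carrier K"
    then obtain b a c where u: "u = F (b, a, c)" using surj by (metis rangeE surj_pair)
    \<comment> \<open>Reducing \<open>a\<close> modulo \<open>p\<close> splits off
      \<open>a div p\<close> copies of \<open>x^p = z^e\<close>, which are carried into the exponent
      of \<open>z\<close>.\<close>
    define c' where "c' = (c + int e * (a div int p)) mod int p"
    have "int p dvd c + int e * (a div int p) - c'" by (simp add: c'_def)
    hence "int p * int p dvd int p * (c + int e * (a div int p) - c')" by simp
    also have "int p * (c + int e * (a div int p) - c') = int e * (a - a mod int p) + int p * (c - c')"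
      by (simp add: minus_mod_eq_mult_div algebra_simps)
    finally have "u = F (b mod int p, a mod int p, c')" by (simp add: u F_eq_iff)
    moreover have "(b mod int p, a mod int p, c') \<in> box" using p_pos by (simp add: box_def c'_def)
    ultimately show "u \<in> F ` box" by blast
  qed auto
qed

lemma card_box:
  assumes S: "S \<subseteq> carrier K"
  shows "card S = card {t \<in> box. F t \<in> S}"
proof -
  have eq: "F ` {t \<in> box. F t \<in> S} = S"
  proof (rule equalityI; rule subsetI)
    fix u assume u: "u \<in> S"
    hence "u \<in> F ` box" using S bij_betw_imp_surj_on[OF bij_box] by auto
    thus "u \<in> F ` {t \<in> box. F t \<in> S}" using u by auto
  qed auto
  have "inj_on F {t \<in> box. F t \<in> S}"
    using bij_betw_imp_inj_on[OF bij_box] by (rule inj_on_subset) auto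
  from card_image[OF this] show ?thesis unfolding eq .
qed

lemma finite_K: "finite (carrier K)"
  using bij_betw_finite[OF bij_box] by (simp add: box_def)

lemma order_K: "order K = p ^ 3"
  using bij_betw_same_card[OF bij_box]
  by (simp add: box_def order_def card_cartesian_product power3_eq_cube)

text \<open>Up to kernel elements the \<open>p\<close>-th power is \<open>x^(p a)\<close>, and
  \<open>x^p = z^e\<close> turns it into \<open>z^(e a)\<close>.\<close>

lemma pow_p: "F (b, a, c) [^]\<^bsub>K\<^esub> p = F (0, 0, int e * a)"
proof -
  have "p dvd p choose 2"
  proof (rule dvd_choose_prime)
    have "p \<noteq> 2" using p(2) by auto
    thus "2 < p" using prime_gt_1_nat[OF p(1)] by simp
  qed (use p in auto)
  hence "int p * int p dvd int p * (a * b * int (p choose 2))" by (intro mult_dvd_mono) auto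
  moreover have "F (b, a, c) [^]\<^bsub>K\<^esub> p = F (int p * b, int p * a, int p * c + a * b * int (p choose 2))"
    using hom_nat_pow[of "(b, a, c)" p] by (simp add: int_heis_pow)
  ultimately show ?thesis
    by (simp add: F_eq_iff algebra_simps)
qed

lemma pow_p2: "u \<in> carrier K \<Longrightarrow> u [^]\<^bsub>K\<^esub> (p ^ 2) = \<one>\<^bsub>K\<^esub>"
proof -
  assume "u \<in> carrier K"
  then obtain b a c where u: "u = F (b, a, c)" using surj by (metis rangeE surj_pair)
  have "u [^]\<^bsub>K\<^esub> (p ^ 2) = (u [^]\<^bsub>K\<^esub> p) [^]\<^bsub>K\<^esub> p"
    by (simp add: u H.nat_pow_pow power2_eq_square)
  thus ?thesis using hom_one by (simp add: u pow_p)
qed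

lemma center_iff: "F (b, a, c) \<in> group_center K \<longleftrightarrow> int p dvd b \<and> int p dvd a"
proof -
  have comm: "F (b, a, c) \<otimes>\<^bsub>K\<^esub> F (b', a', c') = F (b', a', c') \<otimes>\<^bsub>K\<^esub> F (b, a, c) \<longleftrightarrow> int p dvd a * b' - a' * b"
    for b' a' c'
    using p_pos by (simp add: hom_mult[symmetric] F_eq_iff del: hom_mult)
  show ?thesis
  proof
    assume "F (b, a, c) \<in> group_center K"
    hence "int p dvd a * b' - a' * b" for b' a' using group_centerD(2) comm F_in by metis
    \<comment> \<open>Commutation with \<open>y\<close>, the triple \<open>(1, 0, 0)\<close>, and
      with \<open>x\<close>, the triple \<open>(0, 1, 0)\<close>.\<close>
    from this[of 1 0] this[of 0 1] show "int p dvd b \<and> int p dvd a" by simp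
  next
    assume "int p dvd b \<and> int p dvd a"
    hence *: "F (b, a, c) \<otimes>\<^bsub>K\<^esub> F t = F t \<otimes>\<^bsub>K\<^esub> F (b, a, c)" for t
      by (cases t) (simp add: comm)
    show "F (b, a, c) \<in> group_center K"
    proof (rule group_centerI)
      fix u assume "u \<in> carrier K"
      then obtain t where "u = F t" using surj by blast
      thus "F (b, a, c) \<otimes>\<^bsub>K\<^esub> u = u \<otimes>\<^bsub>K\<^esub> F (b, a, c)" using * by simp
    qed simp
  qed
qed

lemma residue_dvd: "i \<in> {0..<int p} \<Longrightarrow> int p dvd i \<longleftrightarrow> i = 0"
  using residue_eq[of i 0] p_pos by auto

lemma center_box: "{t \<in> box. F t \<in> group_center K} = {0} \<times> {0} \<times> {0..<int p}"
  using p_pos by (auto simp: box_def center_iff residue_dvd)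

lemma card_center: "card (group_center K) = p"
proof -
  have "group_center K \<subseteq> carrier K" by (auto dest: group_centerD(1))
  from card_box[OF this] show ?thesis by (simp add: center_box card_cartesian_product)
qed

text \<open>For \<open>e = 1\<close> the \<open>p\<close>-th power of \<open>y^b x^a z^c\<close> is
  \<open>z^a\<close>. A root of a central \<open>z^d\<close> thus has \<open>a\<close> fixed modulo
  \<open>p\<close>, while \<open>b\<close> and \<open>c\<close> are free.\<close>

lemma card_roots:
  assumes e: "e = 1" and u: "u \<in> group_center K"
  shows "card (roots K p u) = p ^ 2"
proof -
  have "u \<in> F ` box" using bij_betw_imp_surj_on[OF bij_box] group_centerD(1)[OF u] by simp
  then obtain t where "t \<in> box" "u = F t" by blast
  hence "t \<in> {0} \<times> {0} \<times> {0..<int p}" using u center_box by blast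
  then obtain c where c: "u = F (0, 0, c)" "c \<in> {0..<int p}" using \<open>u = F t\<close> by auto
  have "{t \<in> box. F t \<in> roots K p u} = {0..<int p} \<times> {c} \<times> {0..<int p}"
    using p_pos c e residue_eq[of _ c]
    by (auto simp: box_def roots_def pow_p F_eq_iff)
  moreover have "roots K p u \<subseteq> carrier K" by (auto simp: roots_def)
  ultimately show ?thesis
    using card_box[of "roots K p u"] by (simp add: card_cartesian_product power2_eq_square)
qed

lemma central_roots: "e = 1 \<Longrightarrow> central_roots p 1 K"
  using H.is_group finite_K order_K pow_p2 card_center card_roots
  by (simp add: central_roots_def numeral_eq_Suc)

lemma exponent_p: "e = 0 \<Longrightarrow> u \<in> carrier K \<Longrightarrow> u [^]\<^bsub>K\<^esub> p = \<one>\<^bsub>K\<^esub>"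
  using surj hom_one by (metis int_heis_simps(3) mult_zero_left of_nat_0 pow_p rangeE surj_pair)

end

text \<open>Needed because a central power with one factor is only an isomorphic copy of the
  presented group, on the type \<open>nat\<close>.\<close>

lemma int_heis_quotient_iso:
  assumes K: "int_heis_quotient p e K F" and iso: "H \<cong> K" and H: "group H"
  obtains F' where "int_heis_quotient p e H F'"
proof -
  interpret int_heis_quotient p e K F by fact
  have "K \<cong> H" using iso H by (rule group.iso_sym[rotated])
  then obtain h where h: "group_hom K H h" "h ` carrier K = carrier H" "kernel K H h = {\<one>\<^bsub>K\<^esub>}"
    by (rule is_isoE[OF _ H.is_group H])
  have "h \<circ> F \<in> hom int_heis H" using Group.hom_compose[OF homh group_hom.homh[OF h(1)]] .
  moreover have "range (h \<circ> F) = carrier H" using h(2) unfolding surj[symmetric] by (simp add: image_comp)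
  moreover have "(h \<circ> F) t = \<one>\<^bsub>H\<^esub> \<longleftrightarrow> t \<in> int_heis_kernel p e" for t
  proof -
    have "(h \<circ> F) t = \<one>\<^bsub>H\<^esub> \<longleftrightarrow> F t \<in> kernel K H h" by (simp add: kernel_def)
    thus ?thesis using h(3) ker by simp
  qed
  ultimately have "int_heis_quotient p e H (h \<circ> F)"
    using H p by (simp add: int_heis_quotient_def int_heis_quotient_axioms_def group_hom_def group_hom_axioms_def)
  thus ?thesis by (rule that)
qed

section \<open>The presented groups of order p cubed\<close>

primrec word_eval :: "('a, 'b) monoid_scheme \<Rightarrow> ('g \<Rightarrow> 'a) \<Rightarrow> 'g word \<Rightarrow> 'a" where
  "word_eval G \<gamma> [] = \<one>\<^bsub>G\<^esub>"
| "word_eval G \<gamma> (l # w) = (if snd l then \<gamma> (fst l) else inv\<^bsub>G\<^esub> \<gamma> (fst l)) \<otimes>\<^bsub>G\<^esub> word_eval G \<gamma> w"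

abbreviation word_class :: "('g word \<times> 'g word) set \<Rightarrow> 'g word \<Rightarrow> 'g word set" where
  "word_class R u \<equiv> {w. word_eq R u w}"

lemma word_class_eqI: "word_eq R u v \<Longrightarrow> word_class R u = word_class R v"
  by (auto intro: word_eq.trans word_eq.sym)

lemma word_class_in: "word_class R u \<in> carrier (presented_group R)"
  by (auto simp: carrier_presented_group)

lemma one_presented_group: "\<one>\<^bsub>presented_group R\<^esub> = word_class R []"
  by (simp add: presented_group_def)

section \<open>Evaluation of words and maps out of presented groups\<close>

context group
begin

context
  fixes \<gamma> :: "'g \<Rightarrow> 'a"
  assumes \<gamma>: "\<And>g. \<gamma> g \<in> carrier G"
begin

lemma word_eval_closed: "word_eval G \<gamma> w \<in> carrier G"
  using \<gamma> by (induction w) auto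

lemma word_eval_append: "word_eval G \<gamma> (u @ v) = word_eval G \<gamma> u \<otimes> word_eval G \<gamma> v"
  using \<gamma> word_eval_closed by (induction u) (auto simp: m_assoc)

lemma word_eval_gen_power: "word_eval G \<gamma> (gen_power g m) = \<gamma> g [^] m"
proof (induction m)
  case (Suc m)
  thus ?case using nat_pow_Suc2[OF \<gamma>, of g m] by simp
qed simp

lemma word_eval_eq:
  assumes R: "\<And>u v. (u, v) \<in> R \<Longrightarrow> word_eval G \<gamma> u = word_eval G \<gamma> v" and "word_eq R u v"
  shows "word_eval G \<gamma> u = word_eval G \<gamma> v"
  using assms(2) by induction (use R \<gamma> in \<open>auto simp: word_eval_append\<close>)

text \<open>Von Dyck's theorem. The representative picked by \<open>SOME\<close> does not matter, as
  evaluation is constant on classes.\<close>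

lemma presented_group_hom:
  assumes R: "\<And>u v. (u, v) \<in> R \<Longrightarrow> word_eval G \<gamma> u = word_eval G \<gamma> v"
  obtains h where "h \<in> hom (presented_group R) G" "\<And>u. h (word_class R u) = word_eval G \<gamma> u"
proof -
  define h where "h A = word_eval G \<gamma> (SOME w. w \<in> A)" for A
  have h: "h (word_class R u) = word_eval G \<gamma> u" for u
  proof -
    have "(SOME w. w \<in> word_class R u) \<in> word_class R u"
      by (rule someI[of _ u]) (auto intro: word_eq.refl)
    thus ?thesis using word_eval_eq[OF R] by (auto simp: h_def)
  qed
  have "h \<in> hom (presented_group R) G"
    by (rule homI) (auto simp: carrier_presented_group presented_group_mult h word_eval_append word_eval_closed)
  thus ?thesis using h by (rule that)
qed

end

end

lemma hom_word_eval:
  assumes "group G" "group H" "h \<in> hom G H" "\<And>g. \<gamma> g \<in> carrier G"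
  shows "h (word_eval G \<gamma> w) = word_eval H (\<lambda>g. h (\<gamma> g)) w"
proof -
  interpret group_hom G H h using assms by (simp add: group_hom_def group_hom_axioms_def)
  show ?thesis by (induction w) (use assms(4) group.word_eval_closed[OF assms(1), of \<gamma>] in auto)
qed

text \<open>Turns each defining relation into an equation between products of the generators, and
  shows that these generate the group.\<close>

lemma word_eval_presented_group:
  "word_eval (presented_group R) (\<lambda>g. word_class R [(g, True)]) w = word_class R w"
proof (induction w)
  case Nil
  show ?case by (simp add: one_presented_group)
next
  case (Cons l w)
  interpret group "presented_group R" by (rule group_presented_group)
  obtain g b where l: "l = (g, b)" by (cases l)
  have "word_eq R [(g, False), (g, True)] []" using word_eq.cancel[of R g False] by simp
  hence "inv\<^bsub>presented_group R\<^esub> word_class R [(g, True)] = word_class R [(g, False)]"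
    by (intro inv_equality word_class_in)
       (simp add: presented_group_mult one_presented_group word_class_eqI)
  thus ?case using Cons l by (cases b) (simp_all add: presented_group_mult)
qed

lemma presented_group_relation:
  assumes "(u, v) \<in> R"
  shows "word_eval (presented_group R) (\<lambda>g. word_class R [(g, True)]) u =
    word_eval (presented_group R) (\<lambda>g. word_class R [(g, True)]) v"
  unfolding word_eval_presented_group by (rule word_class_eqI[OF word_eq.relation[OF assms]])

lemma presented_group_subgroup_eq:
  assumes "subgroup H (presented_group R)" "\<And>g. word_class R [(g, True)] \<in> H"
  shows "H = carrier (presented_group R)"
proof -
  interpret group "presented_group R" by (rule group_presented_group)
  have "word_eval (presented_group R) (\<lambda>g. word_class R [(g, True)]) w \<in> H" for w
    by (induction w) (use assms in \<open>auto intro: subgroup.one_closed subgroup.m_closed subgroup.m_inv_closed\<close>)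
  hence "word_class R w \<in> H" for w by (simp only: word_eval_presented_group)
  thus ?thesis using subgroup.subset[OF assms(1)] by (auto simp: carrier_presented_group)
qed

section \<open>Homomorphisms from the integer Heisenberg group\<close>

context group
begin

text \<open>Conjugation by \<open>v\<close> is an endomorphism sending \<open>u\<close> to
  \<open>u w\<close>, hence \<open>u^a\<close> to \<open>(u w)^a = u^a w^a\<close>; negative
  exponents are covered without induction.\<close>

lemma int_pow_twisted_commute:
  assumes in_G: "u \<in> carrier G" "v \<in> carrier G" "w \<in> carrier G"
    and uv: "u \<otimes> v = v \<otimes> u \<otimes> w" and uw: "u \<otimes> w = w \<otimes> u"
  shows "u [^] (a::int) \<otimes> v = v \<otimes> u [^] a \<otimes> w [^] a"
proof -
  let ?f = "\<lambda>g. inv v \<otimes> g \<otimes> v"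
  have "?f \<in> hom G G"
  proof (rule homI)
    fix g h assume "g \<in> carrier G" "h \<in> carrier G"
    thus "inv v \<otimes> (g \<otimes> h) \<otimes> v = (inv v \<otimes> g \<otimes> v) \<otimes> (inv v \<otimes> h \<otimes> v)"
      using in_G m_assoc[of v "inv v" "h \<otimes> v"] by (simp add: m_assoc)
  qed (use in_G in simp)
  hence "?f (u [^] a) = ?f u [^] a" using in_G is_group by (intro hom_int_pow)
  also have "?f u = u \<otimes> w" using in_G uv by (simp add: m_assoc inv_solve_left')
  also have "(u \<otimes> w) [^] a = u [^] a \<otimes> w [^] a" using in_G uw by (intro int_pow_mult_distrib)
  finally have "inv v \<otimes> (u [^] a \<otimes> v) = u [^] a \<otimes> w [^] a" using in_G by (simp add: m_assoc)
  thus ?thesis using in_G by (simp add: m_assoc inv_solve_left')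
qed

lemma int_pow_commute:
  assumes "u \<in> carrier G" "v \<in> carrier G" "u \<otimes> v = v \<otimes> u"
  shows "u [^] (a::int) \<otimes> v [^] (b::int) = v [^] b \<otimes> u [^] a"
proof -
  have *: "u [^] (a::int) \<otimes> v = v \<otimes> u [^] a" if "u \<in> carrier G" "v \<in> carrier G" "u \<otimes> v = v \<otimes> u" for u v a
    using int_pow_twisted_commute[of u v \<one> a] that by simp
  show ?thesis using *[of "v" "u [^] a" b] *[of u v a] assms by simp
qed

text \<open>Universal property of \<open>int_heis\<close>: the three equations are all that is used
  in collecting a product of two expressions \<open>y^b x^a z^c\<close> into one.\<close>

lemma int_heis_hom:
  assumes x: "x \<in> carrier G" and y: "y \<in> carrier G" and z: "z \<in> carrier G"
    and xz: "x \<otimes> z = z \<otimes> x" and yz: "y \<otimes> z = z \<otimes> y" and xy: "x \<otimes> y = y \<otimes> x \<otimes> z"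
  shows "(\<lambda>(b, a, c). y [^] b \<otimes> x [^] a \<otimes> z [^] c) \<in> hom int_heis G" (is "?F \<in> _")
proof (rule homI)
  have cXY: "x [^] a \<otimes> y [^] b = y [^] b \<otimes> x [^] a \<otimes> z [^] (a * b)" for a b :: int
  proof -
    have "x [^] a \<otimes> y = y \<otimes> x [^] a \<otimes> z [^] a"
      by (rule int_pow_twisted_commute[OF x y z xy xz])
    \<comment> \<open>Solved for \<open>y x^a\<close>, the relation has the shape required by the
      same lemma, now for powers of \<open>y\<close> and with twist \<open>z^(-a)\<close>.\<close>
    hence "y \<otimes> x [^] a = x [^] a \<otimes> y \<otimes> z [^] (- a)"
      using x y z by (simp add: m_assoc int_pow_mult[symmetric])
    hence "y [^] b \<otimes> x [^] a = x [^] a \<otimes> y [^] b \<otimes> (z [^] (- a)) [^] b"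
      using x y z int_pow_commute[OF z y yz[symmetric], of "- a" 1]
      by (intro int_pow_twisted_commute) auto
    thus ?thesis using x y z by (simp add: m_assoc int_pow_pow int_pow_mult[symmetric])
  qed
  \<comment> \<open>The trailing \<open>t\<close> makes this rule applicable inside right-nested
    products.\<close>
  have cZX: "z [^] c \<otimes> (x [^] a \<otimes> t) = x [^] a \<otimes> (z [^] c \<otimes> t)" if "t \<in> carrier G" for a c :: int and t
    using that x z int_pow_commute[OF z x xz[symmetric], of c a] by (simp add: m_assoc[symmetric])
  fix s t assume "s \<in> carrier int_heis" "t \<in> carrier int_heis"
  obtain b a c b' a' c' where st: "s = (b, a, c)" "t = (b', a', c')" by (metis surj_pair)
  show "?F s \<in> carrier G" using x y z by (simp add: st)
  let ?X = "\<lambda>i::int. x [^] i" and ?Y = "\<lambda>i::int. y [^] i" and ?Z = "\<lambda>i::int. z [^] i"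
  have "?F s \<otimes> ?F t = ?Y b \<otimes> ?X a \<otimes> (?Z c \<otimes> ?Y b') \<otimes> ?X a' \<otimes> ?Z c'"
    using x y z by (simp add: st m_assoc)
  also have "\<dots> = ?Y b \<otimes> (?X a \<otimes> ?Y b') \<otimes> (?Z c \<otimes> ?X a') \<otimes> ?Z c'"
    using x y z by (simp add: int_pow_commute[OF z y yz[symmetric]] m_assoc)
  also have "\<dots> = ?Y b \<otimes> ?Y b' \<otimes> ?X a \<otimes> (?Z (a * b') \<otimes> ?X a') \<otimes> ?Z c \<otimes> ?Z c'"
    using x y z by (simp add: int_pow_commute[OF z x xz[symmetric]] cXY cZX m_assoc)
  also have "\<dots> = (?Y b \<otimes> ?Y b') \<otimes> (?X a \<otimes> ?X a') \<otimes> (?Z (a * b') \<otimes> ?Z c \<otimes> ?Z c')"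
    using x y z by (simp add: cZX m_assoc)
  also have "\<dots> = ?F (s \<otimes>\<^bsub>int_heis\<^esub> t)"
    using x y z by (simp add: st int_pow_mult[symmetric] ac_simps)
  finally show "?F (s \<otimes>\<^bsub>int_heis\<^esub> t) = ?F s \<otimes> ?F t" ..
qed

text \<open>The homomorphism \<open>q\<close> shows that no further relations hold in \<open>G\<close>.\<close>

lemma int_heis_quotientI:
  assumes p: "prime p" "odd p"
    and x: "x \<in> carrier G" and y: "y \<in> carrier G" and z: "z \<in> carrier G"
    and xz: "x \<otimes> z = z \<otimes> x" and yz: "y \<otimes> z = z \<otimes> y" and xy: "x \<otimes> y = y \<otimes> x \<otimes> z"
    and yp: "y [^] p = \<one>" and zp: "z [^] p = \<one>" and xp: "x [^] p = z [^] e"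
    and gen: "\<And>H. subgroup H G \<Longrightarrow> x \<in> H \<Longrightarrow> y \<in> H \<Longrightarrow> z \<in> H \<Longrightarrow> H = carrier G"
    and q: "q \<in> hom G (int_heis Mod int_heis_kernel p e)"
      "q x = int_heis_kernel p e #>\<^bsub>int_heis\<^esub> (0, 1, 0)"
      "q y = int_heis_kernel p e #>\<^bsub>int_heis\<^esub> (1, 0, 0)"
      "q z = int_heis_kernel p e #>\<^bsub>int_heis\<^esub> (0, 0, 1)"
  shows "int_heis_quotient p e G (\<lambda>(b, a, c). y [^] b \<otimes> x [^] a \<otimes> z [^] c)" (is "int_heis_quotient p e G ?F")
proof -
  let ?N = "int_heis_kernel p e" and ?Q = "int_heis Mod int_heis_kernel p e"
  let ?\<kappa> = "\<lambda>t. ?N #>\<^bsub>int_heis\<^esub> t"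
  interpret N: normal ?N int_heis by (rule normal_int_heis_kernel)
  interpret F: group_hom int_heis G ?F
    using int_heis_hom[OF x y z xz yz xy] is_group by (simp add: group_hom_def group_hom_axioms_def)
  interpret q: group_hom G ?Q q
    using q(1) is_group N.factorgroup_is_group by (simp add: group_hom_def group_hom_axioms_def)
  interpret \<kappa>: group_hom int_heis ?Q ?\<kappa>
    using N.r_coset_hom_Mod N.factorgroup_is_group by (simp add: group_hom_def group_hom_axioms_def)
  have "range ?F = carrier G"
  proof (rule gen)
    show "subgroup (range ?F) G" using F.img_is_subgroup by simp
    show "x \<in> range ?F" using x by (intro image_eqI[of _ _ "(0, 1, 0)"]) auto
    show "y \<in> range ?F" using y by (intro image_eqI[of _ _ "(1, 0, 0)"]) auto
    show "z \<in> range ?F" using z by (intro image_eqI[of _ _ "(0, 0, 1)"]) auto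
  qed
  moreover have "?F t = \<one> \<longleftrightarrow> t \<in> ?N" for t
  proof
    obtain b a c where t: "t = (b, a, c)" by (metis surj_pair)
    assume "?F t = \<one>"
    \<comment> \<open>As \<open>q\<close> sends the generators to their cosets, \<open>q\<close>
      after \<open>?F\<close> is the coset map; \<open>?F t = 1\<close> therefore makes the coset of
      \<open>t\<close> trivial.\<close>
    hence "\<one>\<^bsub>?Q\<^esub> = q (y [^] b \<otimes> x [^] a \<otimes> z [^] c)" using q.hom_one by (simp add: t)
    also have "\<dots> = ?\<kappa> (1, 0, 0) [^]\<^bsub>?Q\<^esub> b \<otimes>\<^bsub>?Q\<^esub> ?\<kappa> (0, 1, 0) [^]\<^bsub>?Q\<^esub> a \<otimes>\<^bsub>?Q\<^esub> ?\<kappa> (0, 0, 1) [^]\<^bsub>?Q\<^esub> c"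
      using x y z by (simp only: q.hom_mult q.hom_int_pow m_closed int_pow_closed q(2-4))
    also have "\<dots> = ?\<kappa> ((1, 0, 0) [^]\<^bsub>int_heis\<^esub> b \<otimes>\<^bsub>int_heis\<^esub> (0, 1, 0) [^]\<^bsub>int_heis\<^esub> a \<otimes>\<^bsub>int_heis\<^esub>
        (0, 0, 1) [^]\<^bsub>int_heis\<^esub> c)"
      by (simp only: \<kappa>.hom_mult \<kappa>.hom_int_pow int_heis_simps(1) UNIV_I)
    also have "\<dots> = ?\<kappa> t" by (simp add: int_heis_int_pow t)
    finally have "?\<kappa> t = ?N" by (simp add: FactGroup_def)
    thus "t \<in> ?N" using group.coset_join1[OF group_int_heis] N.subset N.subgroup_axioms by simp
  next
    assume "t \<in> ?N"
    then obtain b a c where t: "t = (b, a, c)"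
      and d: "int p dvd b" "int p dvd a" "int p * int p dvd int e * a + int p * c"
      by (auto simp: int_heis_kernel_def)
    obtain \<beta> \<alpha> where ba: "b = int p * \<beta>" "a = int p * \<alpha>" using d by (auto elim!: dvdE)
    have "int p * int p dvd int p * (int e * \<alpha> + c)" using d(3) by (simp add: ba algebra_simps)
    hence "int p dvd int e * \<alpha> + c" using prime_gt_0_nat[OF p(1)] by simp
    then obtain \<delta> where \<delta>: "int e * \<alpha> + c = int p * \<delta>" by (elim dvdE)
    have split: "g [^] (int m * i) = (g [^] m) [^] i" if "g \<in> carrier G" for g m and i :: int
      using that int_pow_pow[of g "int m" i] by (simp add: int_pow_int)
    have "?F t = (y [^] p) [^] \<beta> \<otimes> (x [^] p) [^] \<alpha> \<otimes> z [^] c"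
      using x y by (simp add: t ba split)
    also have "\<dots> = z [^] (int e * \<alpha>) \<otimes> z [^] c"
      using z by (simp add: yp xp split)
    also have "\<dots> = z [^] (int p * \<delta>)" unfolding \<delta>[symmetric] by (rule int_pow_mult[OF z, symmetric])
    also have "\<dots> = (z [^] p) [^] \<delta>" by (rule split[OF z])
    finally show "?F t = \<one>" by (simp add: zp)
  qed
  ultimately show ?thesis
    using p F.group_hom_axioms by (simp add: int_heis_quotient_def int_heis_quotient_axioms_def)
qed

lemma commutator_word:
  assumes "x \<in> carrier G" "y \<in> carrier G" "w \<in> carrier G" "inv x \<otimes> (inv y \<otimes> (x \<otimes> y)) = w"
  shows "x \<otimes> y = y \<otimes> x \<otimes> w"
  using assms by (simp add: inv_solve_left' m_assoc)

end

text \<open>By von Dyck's theorem it suffices that the relators lie in the kernel, which is integer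
  arithmetic. The resulting map is what keeps the presented group from collapsing.\<close>

lemma presented_group_hom_int_heis:
  assumes "\<And>u v. (u, v) \<in> R \<Longrightarrow> word_eval int_heis \<gamma> u \<otimes>\<^bsub>int_heis\<^esub> inv\<^bsub>int_heis\<^esub> word_eval int_heis \<gamma> v
      \<in> int_heis_kernel p e"
  shows "\<exists>q \<in> hom (presented_group R) (int_heis Mod int_heis_kernel p e).
    \<forall>g. q (word_class R [(g, True)]) = int_heis_kernel p e #>\<^bsub>int_heis\<^esub> \<gamma> g"
proof -
  let ?N = "int_heis_kernel p e" and ?Q = "int_heis Mod int_heis_kernel p e"
  let ?\<kappa> = "\<lambda>t. ?N #>\<^bsub>int_heis\<^esub> t"
  interpret N: normal ?N int_heis by (rule normal_int_heis_kernel)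
  interpret Q: group ?Q by (rule N.factorgroup_is_group)
  have \<kappa>: "?\<kappa> \<in> hom int_heis ?Q" by (rule N.r_coset_hom_Mod)
  have in_Q: "?\<kappa> t \<in> carrier ?Q" for t using hom_in_carrier[OF \<kappa>, of t] by simp
  have "word_eval ?Q (\<lambda>g. ?\<kappa> (\<gamma> g)) u = word_eval ?Q (\<lambda>g. ?\<kappa> (\<gamma> g)) v" if "(u, v) \<in> R" for u v
  proof -
    have "?\<kappa> (word_eval int_heis \<gamma> u) = ?\<kappa> (word_eval int_heis \<gamma> v)"
    proof (rule group.coset_mult_inv1[OF group_int_heis])
      show "?\<kappa> (word_eval int_heis \<gamma> u \<otimes>\<^bsub>int_heis\<^esub> inv\<^bsub>int_heis\<^esub> word_eval int_heis \<gamma> v) = ?N"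
        using assms[OF that] N.subgroup_axioms by (intro group.coset_join2[OF group_int_heis]) auto
    qed auto
    thus ?thesis by (simp only: hom_word_eval[OF group_int_heis Q.is_group \<kappa>] int_heis_simps(1) UNIV_I)
  qed
  then obtain q where q: "q \<in> hom (presented_group R) ?Q"
    "\<And>u. q (word_class R u) = word_eval ?Q (\<lambda>g. ?\<kappa> (\<gamma> g)) u"
    using Q.presented_group_hom[of "\<lambda>g. ?\<kappa> (\<gamma> g)" R] in_Q by blast
  have "q (word_class R [(g, True)]) = ?\<kappa> (\<gamma> g)" for g
    by (simp only: q(2) word_eval.simps fst_conv snd_conv if_True Q.r_one[OF in_Q])
  with q(1) show ?thesis by blast
qed

lemma modular_group_int_heis_quotient:
  assumes p: "prime p" "odd p"
  obtains F where "int_heis_quotient p 1 (modular_group p) F"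
proof -
  define R where "R = {(gen_power MX (p ^ 2), []), (gen_power MY p, []),
      ([(MY, False), (MX, True), (MY, True)], gen_power MX (p + 1))}"
  let ?P = "presented_group R" and ?\<gamma> = "\<lambda>g. word_class R [(g, True)]"
  interpret P: group ?P by (rule group_presented_group)
  have in_P: "?\<gamma> g \<in> carrier ?P" for g by (rule word_class_in)
  have rel: "(u, v) \<in> R \<Longrightarrow> word_eval ?P ?\<gamma> u = word_eval ?P ?\<gamma> v" for u v
    by (rule presented_group_relation)
  note eval = P.word_eval_gen_power[of ?\<gamma>, OF in_P]
  have R: "(gen_power MX (p ^ 2), []) \<in> R" "(gen_power MY p, []) \<in> R" "([(MY, False), (MX, True), (MY, True)], gen_power MX (p + 1)) \<in> R"
    by (simp_all add: R_def)
  \<comment> \<open>The presentation has no third generator; with \<open>z = x^p\<close> the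
    relation \<open>y^(-1) x y = x^(p + 1)\<close> becomes \<open>x y = y x z\<close>.\<close>
  define x y z where "x = ?\<gamma> MX" "y = ?\<gamma> MY" "z = x [^]\<^bsub>?P\<^esub> p"
  have x: "x \<in> carrier ?P" and y: "y \<in> carrier ?P" and z: "z \<in> carrier ?P"
    using in_P by (simp_all add: x_y_z_def)
  have xpp: "x [^]\<^bsub>?P\<^esub> (p ^ 2) = \<one>\<^bsub>?P\<^esub>"
    using rel[OF R(1)] by (simp add: eval x_y_z_def)
  have yp: "y [^]\<^bsub>?P\<^esub> p = \<one>\<^bsub>?P\<^esub>"
    using rel[OF R(2)] by (simp add: eval x_y_z_def)
  have conj: "inv\<^bsub>?P\<^esub> y \<otimes>\<^bsub>?P\<^esub> (x \<otimes>\<^bsub>?P\<^esub> y) = x [^]\<^bsub>?P\<^esub> (p + 1)"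
    using rel[OF R(3)]
    by (simp only: eval) (simp add: x_y_z_def in_P)
  have zp: "z [^]\<^bsub>?P\<^esub> p = \<one>\<^bsub>?P\<^esub>"
    using xpp x by (simp add: x_y_z_def P.nat_pow_pow power2_eq_square)
  have xz: "x \<otimes>\<^bsub>?P\<^esub> z = z \<otimes>\<^bsub>?P\<^esub> x"
    using P.int_pow_commute[OF x x HOL.refl, of 1 "int p"] x by (simp add: x_y_z_def int_pow_int)
  have xy: "x \<otimes>\<^bsub>?P\<^esub> y = y \<otimes>\<^bsub>?P\<^esub> x \<otimes>\<^bsub>?P\<^esub> z"
  proof -
    have "x \<otimes>\<^bsub>?P\<^esub> y = y \<otimes>\<^bsub>?P\<^esub> (z \<otimes>\<^bsub>?P\<^esub> x)"
      using conj x y z P.inv_solve_left'[of "x [^]\<^bsub>?P\<^esub> (p + 1)" y "x \<otimes>\<^bsub>?P\<^esub> y"] by (simp add: x_y_z_def)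
    thus ?thesis using x y z by (simp add: xz P.m_assoc)
  qed
  \<comment> \<open>The twisted relation for the exponent \<open>p\<close> reads
    \<open>x^p y = y x^p z^p\<close>, and \<open>z^p = 1\<close>.\<close>
  have yz: "y \<otimes>\<^bsub>?P\<^esub> z = z \<otimes>\<^bsub>?P\<^esub> y"
    using P.int_pow_twisted_commute[OF x y z xy xz, of "int p"] y z zp by (simp add: x_y_z_def int_pow_int)
  let ?\<delta> = "\<lambda>g. case g of MX \<Rightarrow> (0, 1, 0) | MY \<Rightarrow> (1, 0, 0)"
  have eval': "word_eval int_heis ?\<delta> (gen_power g m) = ?\<delta> g [^]\<^bsub>int_heis\<^esub> m" for g m
    by (rule group.word_eval_gen_power[OF group_int_heis]) simp
  \<comment> \<open>The conjugation relator is the triple \<open>(0, -p, 1)\<close>, which lies in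
    the kernel since \<open>1 * (-p) + p * 1 = 0\<close>.\<close>
  have "word_eval int_heis ?\<delta> u \<otimes>\<^bsub>int_heis\<^esub> inv\<^bsub>int_heis\<^esub> word_eval int_heis ?\<delta> v \<in> int_heis_kernel p 1"
    if "(u, v) \<in> R" for u v
    using that unfolding R_def
    by (elim insertE emptyE Pair_inject)
       (simp_all only: eval' modular_gen.case int_heis_pow,
        simp_all add: int_heis_kernel_def power2_eq_square algebra_simps)
  hence "\<exists>q \<in> hom ?P (int_heis Mod int_heis_kernel p 1).
      \<forall>g. q (?\<gamma> g) = int_heis_kernel p 1 #>\<^bsub>int_heis\<^esub> ?\<delta> g"
    by (rule presented_group_hom_int_heis)
  then obtain q where q: "q \<in> hom ?P (int_heis Mod int_heis_kernel p 1)"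
    "\<And>g. q (?\<gamma> g) = int_heis_kernel p 1 #>\<^bsub>int_heis\<^esub> ?\<delta> g" by blast
  interpret N: normal "int_heis_kernel p 1" int_heis by (rule normal_int_heis_kernel)
  \<comment> \<open>As \<open>z\<close> is not a generator, its image is computed from
    \<open>q x\<close>: for \<open>e = 1\<close> the triples \<open>(0, p, 0)\<close> and
    \<open>(0, 0, 1)\<close> lie in the same coset.\<close>
  have qz: "q z = int_heis_kernel p 1 #>\<^bsub>int_heis\<^esub> (0, 0, 1)"
  proof -
    have "q z = q x [^]\<^bsub>int_heis Mod int_heis_kernel p 1\<^esub> p"
      using hom_nat_pow[OF q(1) x P.is_group N.factorgroup_is_group] by (simp add: x_y_z_def)
    also have "\<dots> = int_heis_kernel p 1 #>\<^bsub>int_heis\<^esub> ((0, 1, 0) [^]\<^bsub>int_heis\<^esub> p)"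
      using hom_nat_pow[OF N.r_coset_hom_Mod _ group_int_heis N.factorgroup_is_group, of "(0, 1, 0)" p] q(2)[of MX]
      by (simp add: x_y_z_def)
    also have "\<dots> = int_heis_kernel p 1 #>\<^bsub>int_heis\<^esub> (0, 0, 1)"
    proof (rule group.coset_mult_inv1[OF group_int_heis])
      show "int_heis_kernel p 1 #>\<^bsub>int_heis\<^esub>
          ((0, 1, 0) [^]\<^bsub>int_heis\<^esub> p \<otimes>\<^bsub>int_heis\<^esub> inv\<^bsub>int_heis\<^esub> (0, 0, 1)) = int_heis_kernel p 1"
        by (rule group.coset_join2[OF group_int_heis _ N.subgroup_axioms])
           (simp_all add: int_heis_pow int_heis_kernel_def)
    qed auto
    finally show ?thesis .
  qed
  have "int_heis_quotient p 1 ?P (\<lambda>(b, a, c). y [^]\<^bsub>?P\<^esub> b \<otimes>\<^bsub>?P\<^esub> x [^]\<^bsub>?P\<^esub> a \<otimes>\<^bsub>?P\<^esub> z [^]\<^bsub>?P\<^esub> c)"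
  proof (rule P.int_heis_quotientI[OF p x y z xz yz xy yp zp _ _ q(1)])
    fix H assume H: "subgroup H ?P" "x \<in> H" "y \<in> H" "z \<in> H"
    have "?\<gamma> g \<in> H" for g using H by (cases g) (simp_all add: x_y_z_def)
    thus "H = carrier ?P" by (rule presented_group_subgroup_eq[OF H(1)])
  qed (use q(2)[of MX] q(2)[of MY] qz z in \<open>simp_all add: x_y_z_def\<close>)
  thus ?thesis using that by (simp add: modular_group_def R_def)
qed

lemma heisenberg_group_int_heis_quotient:
  assumes p: "prime p" "odd p"
  obtains F where "int_heis_quotient p 0 (heisenberg_group p) F"
proof -
  define R where "R = {(gen_power HX p, []), (gen_power HY p, []), (gen_power HZ p, []),
      (gen_commutator HX HZ, []), (gen_commutator HY HZ, []),
      (gen_commutator HX HY, [(HZ, True)])}"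
  let ?P = "presented_group R" and ?\<gamma> = "\<lambda>g. word_class R [(g, True)]"
  interpret P: group ?P by (rule group_presented_group)
  have in_P: "?\<gamma> g \<in> carrier ?P" for g by (rule word_class_in)
  have rel: "(u, v) \<in> R \<Longrightarrow> word_eval ?P ?\<gamma> u = word_eval ?P ?\<gamma> v" for u v
    by (rule presented_group_relation)
  note eval = P.word_eval_gen_power[of ?\<gamma>, OF in_P]
  have R: "(gen_power HX p, []) \<in> R" "(gen_power HY p, []) \<in> R" "(gen_power HZ p, []) \<in> R" "(gen_commutator HX HZ, []) \<in> R" "(gen_commutator HY HZ, []) \<in> R" "(gen_commutator HX HY, [(HZ, True)]) \<in> R"
    by (simp_all add: R_def)
  define x y z where "x = ?\<gamma> HX" "y = ?\<gamma> HY" "z = ?\<gamma> HZ"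
  have x: "x \<in> carrier ?P" and y: "y \<in> carrier ?P" and z: "z \<in> carrier ?P"
    using in_P by (simp_all add: x_y_z_def)
  \<comment> \<open>Written as \<open>z^0\<close> to have the shape \<open>x^p = z^e\<close> with
    \<open>e = 0\<close>.\<close>
  have xp: "x [^]\<^bsub>?P\<^esub> p = z [^]\<^bsub>?P\<^esub> (0::nat)"
    using rel[OF R(1)] by (simp add: eval x_y_z_def)
  have yp: "y [^]\<^bsub>?P\<^esub> p = \<one>\<^bsub>?P\<^esub>"
    using rel[OF R(2)] by (simp add: eval x_y_z_def)
  have zp: "z [^]\<^bsub>?P\<^esub> p = \<one>\<^bsub>?P\<^esub>"
    using rel[OF R(3)] by (simp add: eval x_y_z_def)
  have xz: "x \<otimes>\<^bsub>?P\<^esub> z = z \<otimes>\<^bsub>?P\<^esub> x"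
    using rel[OF R(4)] x z P.commutator_word[of x z "\<one>\<^bsub>?P\<^esub>"]
    by (simp add: gen_commutator_def x_y_z_def in_P)
  have yz: "y \<otimes>\<^bsub>?P\<^esub> z = z \<otimes>\<^bsub>?P\<^esub> y"
    using rel[OF R(5)] y z P.commutator_word[of y z "\<one>\<^bsub>?P\<^esub>"]
    by (simp add: gen_commutator_def x_y_z_def in_P)
  have xy: "x \<otimes>\<^bsub>?P\<^esub> y = y \<otimes>\<^bsub>?P\<^esub> x \<otimes>\<^bsub>?P\<^esub> z"
    using rel[OF R(6)] x y z P.commutator_word[of x y z]
    by (simp add: gen_commutator_def x_y_z_def in_P)
  let ?\<delta> = "\<lambda>g. case g of HX \<Rightarrow> (0, 1, 0) | HY \<Rightarrow> (1, 0, 0) | HZ \<Rightarrow> (0, 0, 1)"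
  have eval': "word_eval int_heis ?\<delta> (gen_power g m) = ?\<delta> g [^]\<^bsub>int_heis\<^esub> m" for g m
    by (rule group.word_eval_gen_power[OF group_int_heis]) simp
  have "word_eval int_heis ?\<delta> u \<otimes>\<^bsub>int_heis\<^esub> inv\<^bsub>int_heis\<^esub> word_eval int_heis ?\<delta> v \<in> int_heis_kernel p 0"
    if "(u, v) \<in> R" for u v
    using that unfolding R_def
    by (elim insertE emptyE Pair_inject)
       (simp_all add: eval' int_heis_pow int_heis_kernel_def gen_commutator_def)
  hence "\<exists>q \<in> hom ?P (int_heis Mod int_heis_kernel p 0).
      \<forall>g. q (?\<gamma> g) = int_heis_kernel p 0 #>\<^bsub>int_heis\<^esub> ?\<delta> g"
    by (rule presented_group_hom_int_heis)
  then obtain q where q: "q \<in> hom ?P (int_heis Mod int_heis_kernel p 0)"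
    "\<And>g. q (?\<gamma> g) = int_heis_kernel p 0 #>\<^bsub>int_heis\<^esub> ?\<delta> g" by blast
  have "int_heis_quotient p 0 ?P (\<lambda>(b, a, c). y [^]\<^bsub>?P\<^esub> b \<otimes>\<^bsub>?P\<^esub> x [^]\<^bsub>?P\<^esub> a \<otimes>\<^bsub>?P\<^esub> z [^]\<^bsub>?P\<^esub> c)"
  proof (rule P.int_heis_quotientI[OF p x y z xz yz xy yp zp xp _ q(1)])
    fix H assume H: "subgroup H ?P" "x \<in> H" "y \<in> H" "z \<in> H"
    have "?\<gamma> g \<in> H" for g using H by (cases g) (simp_all add: x_y_z_def)
    thus "H = carrier ?P" by (rule presented_group_subgroup_eq[OF H(1)])
  qed (use q(2)[of HX] q(2)[of HY] q(2)[of HZ] in \<open>simp_all add: x_y_z_def\<close>)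
  thus ?thesis using that by (simp add: heisenberg_group_def R_def)
qed

section \<open>Central powers\<close>

lemma central_roots_central_power:
  assumes p: "prime p" "odd p" and n: "n \<ge> 1" and K: "is_central_power p (modular_group p) n K"
  shows "central_roots p n K"
proof -
  obtain F where F: "int_heis_quotient p 1 (modular_group p) F"
    using modular_group_int_heis_quotient[OF p] .
  \<comment> \<open>The first factor is a copy on \<open>nat\<close>, whereas every later factor is
    the presented group itself; the induction uses both.\<close>
  have modular: "central_roots p 1 H" if H: "group H" "H \<cong> modular_group p" for H :: "nat monoid"
  proof -
    obtain F' where F': "int_heis_quotient p 1 H F'" by (rule int_heis_quotient_iso[OF F H(2,1)])
    show ?thesis by (rule int_heis_quotient.central_roots[OF F' HOL.refl])
  qed
  have M: "central_roots p 1 (modular_group p)"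
    by (rule int_heis_quotient.central_roots[OF F HOL.refl])
  show ?thesis
    using n K
  proof (induction n arbitrary: K rule: dec_induct)
    case base
    thus ?case using modular by simp
  next
    case (step n)
    then obtain m where m: "n = Suc m" by (cases n) auto
    from step.prems obtain L where L: "is_central_power p (modular_group p) n L"
      "is_central_product p L (modular_group p) K" by (auto simp: m)
    show ?case
      using central_roots_central_product[OF step.IH[OF L(1)] M L(2)] prime_gt_0_nat[OF p(1)] by simp
  qed
qed

lemma int_heis_quotient_exponent:
  assumes "int_heis_quotient p 0 H F"
  shows "group H \<and> finite (carrier H) \<and> order H = p ^ (2 * 1 + 1) \<and>
    (\<forall>x\<in>carrier H. x [^]\<^bsub>H\<^esub> p = \<one>\<^bsub>H\<^esub>)"
proof -
  interpret int_heis_quotient p 0 H F by fact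
  show ?thesis using H.is_group finite_K order_K exponent_p by (simp add: numeral_eq_Suc)
qed

lemma exponent_central_power:
  assumes p: "prime p" "odd p" and n: "n \<ge> 1" and K: "is_central_power p (heisenberg_group p) n K"
  shows "group K \<and> finite (carrier K) \<and> order K = p ^ (2 * n + 1) \<and>
    (\<forall>x\<in>carrier K. x [^]\<^bsub>K\<^esub> p = \<one>\<^bsub>K\<^esub>)"
proof -
  obtain F where F: "int_heis_quotient p 0 (heisenberg_group p) F"
    using heisenberg_group_int_heis_quotient[OF p] .
  have M: "group (heisenberg_group p)" "finite (carrier (heisenberg_group p))"
    "order (heisenberg_group p) = p ^ (2 * 1 + 1)"
    "\<forall>x\<in>carrier (heisenberg_group p). x [^]\<^bsub>heisenberg_group p\<^esub> p = \<one>\<^bsub>heisenberg_group p\<^esub>"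
    using int_heis_quotient_exponent[OF F] by auto
  show ?thesis
    using n K
  proof (induction n arbitrary: K rule: dec_induct)
    case base
    then obtain F' where "int_heis_quotient p 0 K F'" using int_heis_quotient_iso[OF F] by auto
    thus ?case by (rule int_heis_quotient_exponent)
  next
    case (step n)
    then obtain m where m: "n = Suc m" by (cases n) auto
    from step.prems obtain L where L: "is_central_power p (heisenberg_group p) n L"
      "is_central_product p L (heisenberg_group p) K" by (auto simp: m)
    note IH = step.IH[OF L(1)]
    show ?case
      using exponent_central_product[of L p n "heisenberg_group p" 1 K] IH M L(2) prime_gt_0_nat[OF p(1)] by simp
  qed
qed

section \<open>Arithmetic of the counts and the six families\<close>

lemma counts_profile_same:
  assumes "prime p" "has_profile p (p ^ i) (p ^ i) G"
  shows "num_of_order p G = p ^ i - 1 \<and> psi G = p ^ (i + 1) - p + 1"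
  using has_profile_counts[OF assms] by (simp add: right_diff_distrib')

lemma counts_profile_p:
  assumes "prime p" "has_profile p (p * p ^ i) (p ^ i) G"
  shows "num_of_order p G = p ^ i - 1 \<and> num_of_order (p ^ 2) G = (p - 1) * p ^ i \<and>
    psi G = (p - 1) * p ^ (i + 2) + p * (p ^ i - 1) + 1"
  using has_profile_counts[OF assms] by (simp add: diff_mult_distrib power2_eq_square algebra_simps)

theorem theorem2p7:
  fixes p n k :: nat and G :: "('a, 'b) monoid_scheme"
  assumes "prime p" and "odd p"
    and "extraspecial p G \<or> almost_extraspecial p G \<or> generalized_extraspecial p G"
    and "n \<ge> 1"
  shows
    "(\<forall>H. is_central_power p (heisenberg_group p) n H \<and> G \<cong> H \<longrightarrow>
        num_of_order p G = p ^ (2 * n + 1) - 1 \<and>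
        psi G = p ^ (2 * n + 2) - p + 1) \<and>
     (\<forall>H. is_central_power p (modular_group p) n H \<and> G \<cong> H \<longrightarrow>
        num_of_order p G = p ^ (2 * n) - 1 \<and>
        num_of_order (p ^ 2) G = (p - 1) * p ^ (2 * n) \<and>
        psi G = (p - 1) * p ^ (2 * n + 2) + p * (p ^ (2 * n) - 1) + 1) \<and>
     (\<forall>H (L :: nat monoid). is_central_power p (heisenberg_group p) n H \<and>
        is_central_product p H (integer_mod_group (p ^ 2)) L \<and> G \<cong> L \<longrightarrow>
        num_of_order p G = p ^ (2 * n + 1) - 1 \<and>
        num_of_order (p ^ 2) G = (p - 1) * p ^ (2 * n + 1) \<and>
        psi G = (p - 1) * p ^ (2 * n + 3) + p * (p ^ (2 * n + 1) - 1) + 1) \<and>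
     (\<forall>H. is_central_power p (heisenberg_group p) n H \<and> G \<cong> H \<times>\<times> cyclic_power p k \<longrightarrow>
        num_of_order p G = p ^ (2 * n + k + 1) - 1 \<and>
        psi G = p ^ (2 * n + k + 2) - p + 1) \<and>
     (\<forall>H. is_central_power p (modular_group p) n H \<and> G \<cong> H \<times>\<times> cyclic_power p k \<longrightarrow>
        num_of_order p G = p ^ (2 * n + k) - 1 \<and>
        num_of_order (p ^ 2) G = (p - 1) * p ^ (2 * n + k) \<and>
        psi G = (p - 1) * p ^ (2 * n + k + 2) + p * (p ^ (2 * n + k) - 1) + 1) \<and>
     (\<forall>H (L :: nat monoid). is_central_power p (heisenberg_group p) n H \<and>
        is_central_product p H (integer_mod_group (p ^ 2)) L \<and> G \<cong> L \<times>\<times> cyclic_power p k \<longrightarrow>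
        num_of_order p G = p ^ (2 * n + k + 1) - 1 \<and>
        num_of_order (p ^ 2) G = (p - 1) * p ^ (2 * n + k + 1) \<and>
        psi G = (p - 1) * p ^ (2 * n + k + 3) + p * (p ^ (2 * n + k + 1) - 1) + 1)"
proof -
  have p0: "p > 0" using assms(1) prime_gt_0_nat by blast
  have G: "group G"
    using assms(3) by (auto simp: extraspecial_def special_def almost_extraspecial_def
        generalized_extraspecial_def finite_p_group_def)
  note He = exponent_central_power[OF assms(1,2,4)]
  note iso = has_profile_iso[OF _ G]
  note times = has_profile_DirProd[OF _ has_profile_cyclic_power[OF p0, of k]]
  \<comment> \<open>Facts 1 to 6 give the profiles of the six families, in the order of the
    conclusion.\<close>
  have 1: "has_profile p (p ^ (2 * n + 1)) (p ^ (2 * n + 1)) H"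
    if "is_central_power p (heisenberg_group p) n H" for H
    using He[OF that] by (intro group.has_profile_exponent) auto
  have 2: "has_profile p (p * p ^ (2 * n)) (p ^ (2 * n)) H"
    if "is_central_power p (modular_group p) n H" for H
    using central_roots_profile[OF central_roots_central_power[OF assms(1,2,4) that]] by simp
  have 3: "has_profile p (p * p ^ (2 * n + 1)) (p ^ (2 * n + 1)) L"
    if "is_central_power p (heisenberg_group p) n H"
      "is_central_product p H (integer_mod_group (p ^ 2)) L" for H and L :: "nat monoid"
    using has_profile_central_product_cyclic[OF _ _ _ _ that(2) p0] He[OF that(1)] by blast
  have 4: "has_profile p (p ^ (2 * n + k + 1)) (p ^ (2 * n + k + 1)) (H \<times>\<times> cyclic_power p k)"
    if "is_central_power p (heisenberg_group p) n H" for H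
    using times[OF 1[OF that]] by (simp add: power_add ac_simps)
  have 5: "has_profile p (p * p ^ (2 * n + k)) (p ^ (2 * n + k)) (H \<times>\<times> cyclic_power p k)"
    if "is_central_power p (modular_group p) n H" for H
    using times[OF 2[OF that]] by (simp add: power_add ac_simps)
  have 6: "has_profile p (p * p ^ (2 * n + k + 1)) (p ^ (2 * n + k + 1)) (L \<times>\<times> cyclic_power p k)"
    if "is_central_power p (heisenberg_group p) n H"
      "is_central_product p H (integer_mod_group (p ^ 2)) L" for H and L :: "nat monoid"
    using times[OF 3[OF that]] by (simp add: power_add ac_simps)
  note same = counts_profile_same[OF assms(1) iso]
  note prof = counts_profile_p[OF assms(1) iso]
  \<comment> \<open>The count lemmas produce exponents of the form \<open>i + 1\<close> and
    \<open>i + 2\<close>; facts and goal are brought to one shape so that \<open>blast\<close> can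
    match them.\<close>
  have idx: "2 * n + 2 = 2 * n + 1 + 1" "2 * n + 3 = 2 * n + 1 + 2"
    "2 * n + k + 2 = 2 * n + k + 1 + 1" "2 * n + k + 3 = 2 * n + k + 1 + 2" by simp_all
  show ?thesis
    using same[OF _ 1] prof[OF _ 2] prof[OF _ 3] same[OF _ 4] prof[OF _ 5] prof[OF _ 6]
    unfolding idx by blast
qed

end
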